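(* There is no polynomial $p$ such that for every XOR-clause-set $F$ there exists a UR-representation $F'$ of $F$ (a clause-set) with $\ell(F') \le p(\ell(F))$.
   Context: Literals are variables $v$ or their complements $\overline{v}$ (with $\overline{\overline{x}}=x$). A clause is a finite set of literals containing no complementary pair; $\bot$ is the empty clause. A clause-set is a finite set of clauses (read as a CNF); $\top$ is the empty clause-set. $\mathrm{var}(F)$ is the set of variables occurring in $F$; $\ell(F)=\sum_{C\in F}|C|$. A partial assignment $\varphi$ maps a finite set $\mathrm{var}(\varphi)$ of variables to $\{0,1\}$; $\varphi * F$ is obtained by deleting clauses containing a literal set to $1$ and deleting literals set to $0$ from the remaining clauses. $F$ is satisfiable iff some $\varphi$ gives $\varphi*F=\top$. Unit-clause propagation $r_1$: $r_1(F)=\{\bot\}$ if $\bot\in F$; if $F$ contains a unit clause $\{x\}$, $r_1(F)=r_1(\langle x\to 1\rangle * F)$; otherwise $r_1(F)=F$. An XOR-clause is a clause $C$ read as the constraint $\bigoplus_{x\in C} x = 0$ over $\mathbb{Z}_2$ (the value of $\overline{v}$ being $1\oplus v$); an XOR-clause-set is a finite set of XOR-clauses read as their conjunction, defining a boolean function on the variables $\mathrm{var}(F)$. A CNF-representation of an XOR-clause-set $F$ is a clause-set $F'$ with $\mathrm{var}(F)\subseteq \mathrm{var}(F')$ such that for every total assignment $\varphi$ of $\mathrm{var}(F)$, $\varphi*F'$ is satisfiable iff $\varphi$ satisfies $F$ (as XOR-clause-set). It is a UR-representation if moreover for every partial assignment $\varphi$ with $\mathrm{var}(\varphi)\subseteq\mathrm{var}(F)$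 such that $\varphi*F'$ is unsatisfiable, $r_1(\varphi*F')=\{\bot\}$. *)

theory Defs
  imports "HOL-Library.Z2" "HOL-Computational_Algebra.Polynomial"
begin

datatype 'v lit = Pos 'v | Neg 'v

fun compl_lit :: "'v lit \<Rightarrow> 'v lit" where
  "compl_lit (Pos v) = Neg v"
| "compl_lit (Neg v) = Pos v"

fun var_lit :: "'v lit \<Rightarrow> 'v" where
  "var_lit (Pos v) = v"
| "var_lit (Neg v) = v"

type_synonym 'v cls = "'v lit set"

definition is_clause :: "'v cls \<Rightarrow> bool" where
  "is_clause C \<longleftrightarrow> finite C \<and> (\<forall>x\<in>C. compl_lit x \<notin> C)"

definition is_clause_set :: "'v cls set \<Rightarrow> bool" where
  "is_clause_set F \<longleftrightarrow> finite F \<and> (\<forall>C\<in>F. is_clause C)"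

definition vars :: "'v cls set \<Rightarrow> 'v set" where
  "vars F = var_lit ` \<Union>F"

definition lit_count :: "'v cls set \<Rightarrow> nat" where
  "lit_count F = (\<Sum>C\<in>F. card C)"

text \<open>Truth values live in the two-element field, so that XOR is addition.\<close>

type_synonym 'v passign = "'v \<rightharpoonup> bit"

definition is_passign :: "'v passign \<Rightarrow> bool" where
  "is_passign \<phi> \<longleftrightarrow> finite (dom \<phi>)"

fun lit_val :: "'v passign \<Rightarrow> 'v lit \<Rightarrow> bit option" where
  "lit_val \<phi> (Pos v) = \<phi> v"
| "lit_val \<phi> (Neg v) = map_option (\<lambda>b. 1 + b) (\<phi> v)"

definition apply_pa :: "'v passign \<Rightarrow> 'v cls set \<Rightarrow> 'v cls set" where
  "apply_pa \<phi> F =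
     (\<lambda>C. {x \<in> C. lit_val \<phi> x \<noteq> Some 0}) ` {C \<in> F. \<forall>x\<in>C. lit_val \<phi> x \<noteq> Some 1}"

definition satisfiable :: "'v cls set \<Rightarrow> bool" where
  "satisfiable F \<longleftrightarrow> (\<exists>\<phi>. is_passign \<phi> \<and> apply_pa \<phi> F = {})"

fun set_true :: "'v lit \<Rightarrow> 'v passign" where
  "set_true (Pos v) = [v \<mapsto> 1]"
| "set_true (Neg v) = [v \<mapsto> 0]"

text \<open>The recursion for unit-clause propagation does not say which unit clause is
  propagated. The relation below admits every choice; it is functional and, on
  clause-sets, total (\<open>unit_prop_unique\<close>, \<open>unit_prop_ex\<close>), so \<open>r1\<close> is well-defined.\<close>

inductive unit_prop :: "'v cls set \<Rightarrow> 'v cls set \<Rightarrow> bool" where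
  conflict: "{} \<in> F \<Longrightarrow> unit_prop F {{}}"
| unit: "{} \<notin> F \<Longrightarrow> {x} \<in> F \<Longrightarrow> unit_prop (apply_pa (set_true x) F) G \<Longrightarrow> unit_prop F G"
| stop: "{} \<notin> F \<Longrightarrow> \<forall>x. {x} \<notin> F \<Longrightarrow> unit_prop F F"

definition r1 :: "'v cls set \<Rightarrow> 'v cls set" where
  "r1 F = (THE G. unit_prop F G)"

lemma lit_val_set_true:
  "lit_val (set_true x) y = (if y = x then Some 1 else if y = compl_lit x then Some 0 else None)"
  by (cases x; cases y) auto

lemma apply_set_true:
  "apply_pa (set_true x) F = (\<lambda>C. C - {compl_lit x}) ` {C \<in> F. x \<notin> C}"
proof -
  have *: "x \<noteq> compl_lit x" by (cases x) auto
  have "(\<forall>y\<in>C. lit_val (set_true x) y \<noteq> Some 1) \<longleftrightarrow> x \<notin> C" for C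
    using * by (auto simp: lit_val_set_true)
  moreover have "{y \<in> C. lit_val (set_true x) y \<noteq> Some 0} = C - {compl_lit x}" for C
    using * by (auto simp: lit_val_set_true)
  ultimately show ?thesis by (simp add: apply_pa_def)
qed

lemma compl_compl [simp]: "compl_lit (compl_lit x) = x"
  by (cases x) auto

lemma compl_neq [simp]: "compl_lit x \<noteq> x" "x \<noteq> compl_lit x"
  by (cases x; simp)+

lemma apply_set_true_commute:
  assumes "y \<noteq> x" "y \<noteq> compl_lit x"
  shows "apply_pa (set_true x) (apply_pa (set_true y) F) =
         apply_pa (set_true y) (apply_pa (set_true x) F)"
proof -
  have n: "x \<noteq> compl_lit y" using assms by auto
  have "{C \<in> (\<lambda>C. C - {compl_lit y}) ` {C \<in> F. y \<notin> C}. x \<notin> C} =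
        (\<lambda>C. C - {compl_lit y}) ` {C \<in> F. y \<notin> C \<and> x \<notin> C}"
    using n by auto
  moreover have "{C \<in> (\<lambda>C. C - {compl_lit x}) ` {C \<in> F. x \<notin> C}. y \<notin> C} =
        (\<lambda>C. C - {compl_lit x}) ` {C \<in> F. y \<notin> C \<and> x \<notin> C}"
    using assms by auto
  ultimately show ?thesis
    unfolding apply_set_true by (simp only: image_image) (intro image_cong refl, blast)
qed

lemma finite_vars: "is_clause_set F \<Longrightarrow> finite (vars F)"
  by (auto simp: is_clause_set_def is_clause_def vars_def)

lemma vars_apply_set_true: "vars (apply_pa (set_true x) F) \<subseteq> vars F - {var_lit x}"
proof
  fix v assume "v \<in> vars (apply_pa (set_true x) F)"
  then obtain C y where C: "C \<in> F" "x \<notin> C" "y \<in> C" "y \<noteq> compl_lit x" and v: "v = var_lit y"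
    by (auto simp: vars_def apply_set_true)
  then have "y \<noteq> x" by auto
  with C(4) have "var_lit y \<noteq> var_lit x" by (cases x; cases y) auto
  with C v show "v \<in> vars F - {var_lit x}" by (auto simp: vars_def)
qed

lemma vars_unit: "{x} \<in> F \<Longrightarrow> var_lit x \<in> vars F"
  unfolding vars_def by blast

lemma unit_prop_ex_finite: "finite (vars F) \<Longrightarrow> \<exists>G. unit_prop F G"
proof (induction "card (vars F)" arbitrary: F rule: less_induct)
  case less
  show ?case
  proof (cases "{} \<notin> F \<and> (\<exists>x. {x} \<in> F)")
    case True
    then obtain x where x: "{} \<notin> F" "{x} \<in> F" by blast
    have sub: "vars (apply_pa (set_true x) F) \<subset> vars F"
      using vars_apply_set_true[of x F] vars_unit[OF x(2)] by blast
    have "finite (vars (apply_pa (set_true x) F))"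
      using sub less.prems by (metis finite_subset psubset_imp_subset)
    from less.hyps[OF psubset_card_mono[OF less.prems sub] this]
    have "\<exists>G. unit_prop (apply_pa (set_true x) F) G" .
    with x show ?thesis by (blast intro: unit_prop.unit)
  next
    case False
    then show ?thesis by (blast intro: unit_prop.conflict unit_prop.stop)
  qed
qed

lemma unit_prop_ex: "is_clause_set F \<Longrightarrow> \<exists>G. unit_prop F G"
  by (simp add: unit_prop_ex_finite finite_vars)

lemma unit_prop_conflict_iff: "{} \<in> F \<Longrightarrow> unit_prop F G \<longleftrightarrow> G = {{}}"
  by (subst unit_prop.simps) simp

lemma empty_in_apply_set_true:
  assumes "{compl_lit x} \<in> F"
  shows "{} \<in> apply_pa (set_true x) F"
  unfolding apply_set_true by (rule image_eqI[of _ _ "{compl_lit x}"]) (use assms in simp_all)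

lemma empty_in_apply_set_trueD:
  assumes "{} \<in> apply_pa (set_true x) F" "{} \<notin> F"
  shows "{compl_lit x} \<in> F"
proof -
  from assms(1) obtain C where C: "C \<in> F" "C - {compl_lit x} = {}"
    unfolding apply_set_true by auto
  from C(2) have "C = {} \<or> C = {compl_lit x}" by blast
  with C(1) assms(2) show ?thesis by metis
qed

lemma unit_in_apply_set_true:
  assumes "{z} \<in> F" "z \<noteq> x" "z \<noteq> compl_lit x"
  shows "{z} \<in> apply_pa (set_true x) F"
  unfolding apply_set_true by (rule image_eqI[of _ _ "{z}"]) (use assms in auto)

lemma unit_prop_any:
  "unit_prop F G \<Longrightarrow> {} \<notin> F \<Longrightarrow> {y} \<in> F \<Longrightarrow> unit_prop (apply_pa (set_true y) F) G"
proof (induction arbitrary: y rule: unit_prop.induct)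
  case (conflict F)
  then show ?case by blast
next
  case (stop F)
  then show ?case by blast
next
  case (unit F x G)
  let ?Fx = "apply_pa (set_true x) F" and ?Fy = "apply_pa (set_true y) F"
  consider "y = x" | "y = compl_lit x" | "y \<noteq> x" "y \<noteq> compl_lit x" by blast
  then show ?case
  proof cases
    case 1
    with unit.hyps(3) show ?thesis by simp
  next
    case 2
    then have "{} \<in> ?Fx" "{} \<in> ?Fy"
      using unit.hyps(2) unit.prems(2) by (simp_all add: empty_in_apply_set_true)
    with unit.hyps(3) show ?thesis by (simp add: unit_prop_conflict_iff)
  next
    case 3
    then have n: "x \<noteq> y" "x \<noteq> compl_lit y" "compl_lit x \<noteq> y" "compl_lit x \<noteq> compl_lit y"
      by (cases x; cases y; simp)+
    have y: "{y} \<in> ?Fx" and x: "{x} \<in> ?Fy"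
      using 3 n unit.hyps(2) unit.prems(2) by (simp_all add: unit_in_apply_set_true)
    have both: "unit_prop (apply_pa (set_true x) ?Fy) G"
    proof (cases "{} \<in> ?Fx")
      case True
      then have "{compl_lit x} \<in> ?Fy"
        using empty_in_apply_set_trueD unit.hyps(1) n(3,4) by (blast intro: unit_in_apply_set_true)
      then have "{} \<in> apply_pa (set_true x) ?Fy" by (rule empty_in_apply_set_true)
      moreover have "G = {{}}" using True unit.hyps(3) by (simp add: unit_prop_conflict_iff)
      ultimately show ?thesis by (simp add: unit_prop_conflict_iff)
    next
      case False
      from unit.IH[OF False y] show ?thesis by (simp only: apply_set_true_commute[OF 3])
    qed
    show ?thesis
    proof (cases "{} \<in> ?Fy")
      case True
      then have "{compl_lit y} \<in> ?Fx"
        using empty_in_apply_set_trueD unit.prems(1) n by (metis unit_in_apply_set_true)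
      then have "{} \<in> apply_pa (set_true y) ?Fx" by (rule empty_in_apply_set_true)
      then have "{} \<in> apply_pa (set_true x) ?Fy" by (simp only: apply_set_true_commute[OF 3])
      with both True show ?thesis by (simp add: unit_prop_conflict_iff)
    next
      case False
      from False x both show ?thesis by (rule unit_prop.unit)
    qed
  qed
qed

lemma unit_prop_unique: "unit_prop F G \<Longrightarrow> unit_prop F H \<Longrightarrow> G = H"
proof (induction arbitrary: H rule: unit_prop.induct)
  case (conflict F)
  then show ?case by (simp add: unit_prop_conflict_iff)
next
  case (unit F x G)
  from unit.IH[OF unit_prop_any[OF unit.prems unit.hyps(1,2)]] show ?case .
next
  case (stop F)
  from stop.prems show ?case by cases (use stop.hyps in auto)
qed

lemma r1_eq: "unit_prop F G \<Longrightarrow> r1 F = G"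
  unfolding r1_def by (rule the_equality) (simp_all add: unit_prop_unique)

lemma r1_conflict: "{} \<in> F \<Longrightarrow> r1 F = {{}}"
  by (simp add: r1_eq unit_prop.conflict)

lemma r1_unit:
  assumes "is_clause_set F" "{} \<notin> F" "{x} \<in> F"
  shows "r1 F = r1 (apply_pa (set_true x) F)"
proof -
  from unit_prop_ex[OF assms(1)] obtain G where G: "unit_prop F G" ..
  from r1_eq[OF G] r1_eq[OF unit_prop_any[OF G assms(2,3)]] show ?thesis by simp
qed

lemma r1_stop: "{} \<notin> F \<Longrightarrow> \<forall>x. {x} \<notin> F \<Longrightarrow> r1 F = F"
  by (simp add: r1_eq unit_prop.stop)

text \<open>An XOR-clause-set is a clause-set under a different reading. The next predicate is
  meant for \<open>\<phi>\<close> assigning all of \<open>vars F\<close>, so that \<open>the\<close> is only applied to defined values.\<close>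

definition xor_sat :: "'v passign \<Rightarrow> 'v cls set \<Rightarrow> bool" where
  "xor_sat \<phi> F \<longleftrightarrow> (\<forall>C\<in>F. (\<Sum>x\<in>C. the (lit_val \<phi> x)) = 0)"

definition cnf_representation :: "'v cls set \<Rightarrow> 'v cls set \<Rightarrow> bool" where
  "cnf_representation F' F \<longleftrightarrow> is_clause_set F' \<and> vars F \<subseteq> vars F' \<and>
     (\<forall>\<phi>. dom \<phi> = vars F \<longrightarrow> (satisfiable (apply_pa \<phi> F') \<longleftrightarrow> xor_sat \<phi> F))"

definition ur_representation :: "'v cls set \<Rightarrow> 'v cls set \<Rightarrow> bool" where
  "ur_representation F' F \<longleftrightarrow> cnf_representation F' F \<and>
     (\<forall>\<phi>. is_passign \<phi> \<and> dom \<phi> \<subseteq> vars F \<and> \<not> satisfiable (apply_pa \<phi> F')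
        \<longrightarrow> r1 (apply_pa \<phi> F') = {{}})"

end

theory Submission
  imports Defs "HOL-Combinatorics.Permutations" "HOL-Library.FuncSet" "HOL-Library.Nat_Bijection"
begin

text \<open>
  The hard instances say that a set of edges of \<open>K\<^bsub>n,n\<^esub>\<close> meets every vertex an odd number of
  times. Setting the edges outside a graph \<open>S\<close> to 0 is consistent iff \<open>S\<close> contains such an odd
  factor, so unit propagation on a UR-representation decides this property of \<open>S\<close>. That a literal
  has \<^emph>\<open>not\<close> been derived after \<open>t\<close> rounds is a monotone property of \<open>S\<close>; hence a
  UR-representation yields a monotone circuit of polynomial size for odd factors.

  Razborov's approximation method shows that no such circuit exists (Babai, Gal and Wigderson
  applied it to odd factors). Graphs of permutations have to be accepted, and the graphs of all
  monochromatic edges have to be rejected for every 2-colouring with an odd colour class. A gate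
  is approximated if, up to few errors, its acceptance of a permutation is witnessed by a
  submatching of at most \<open>k\<close> edges that forces it on all colourings. Disjunctions preserve this.
  For a conjunction, two witnesses unite to a matching of up to \<open>2k\<close> edges; the family of these
  matchings is closed under adding every matching whose colourings are almost covered by those of
  the family, in particular the core of a large sunflower. A closed family has few minimal members
  of each size, and a random permutation rarely contains one with more than \<open>k\<close> edges.
\<close>

section \<open>Counting\<close>

lemma card_permutes_extending_le:
  fixes f :: "'a \<Rightarrow> 'a"
  assumes "finite S" "A \<subseteq> S"
  shows "card {\<pi>. \<pi> permutes S \<and> (\<forall>x\<in>A. \<pi> x = f x)} \<le> fact (card S - card A)"
    (is "card ?P \<le> _")
proof (cases "?P = {}")
  case False
  then obtain \<rho> where \<rho>: "\<rho> permutes S" "\<forall>x\<in>A. \<rho> x = f x" by blast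
  have "inv \<rho> \<circ> \<pi> permutes S - A" if "\<pi> \<in> ?P" for \<pi>
  proof (rule permutes_superset)
    show "inv \<rho> \<circ> \<pi> permutes S"
      using that \<rho>(1) by (auto intro: permutes_compose permutes_inv)
    show "(inv \<rho> \<circ> \<pi>) x = x" if "x \<in> S - (S - A)" for x
      using that \<open>\<pi> \<in> ?P\<close> \<rho> by (auto simp: permutes_inv_eq)
  qed
  moreover have "inj_on ((\<circ>) (inv \<rho>)) ?P"
    using fun.inj_map[OF permutes_inj[OF permutes_inv[OF \<rho>(1)]]] by (rule inj_on_subset) simp
  moreover have "finite {\<sigma>. \<sigma> permutes S - A}" using assms(1) by (simp add: finite_permutations)
  ultimately have "card ?P \<le> card {\<sigma>. \<sigma> permutes S - A}" by (intro card_inj_on_le) auto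
  also have "\<dots> = fact (card (S - A))" using assms(1) by (intro card_permutations) simp_all
  also have "card (S - A) = card S - card A"
    using assms by (intro card_Diff_subset) (auto intro: finite_subset)
  finally show ?thesis .
qed (simp only: card.empty le0)

lemma fact_mult_power_le_fact:
  assumes "r \<le> m" "m \<le> n"
  shows "fact (n - r) * (n - m) ^ r \<le> (fact n :: nat)"
  using assms(1)
proof (induction r)
  case (Suc r)
  have "fact (n - Suc r) * (n - m) ^ Suc r = (n - m) * fact (n - Suc r) * (n - m) ^ r" by simp
  also have "\<dots> \<le> (n - r) * fact (n - Suc r) * (n - m) ^ r"
    using Suc.prems by (intro mult_le_mono) auto
  also have "(n - r) * fact (n - Suc r) = fact (n - r)"
    using Suc.prems assms(2) by (simp add: fact_reduce[of "n - r"])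
  also have "fact (n - r) * (n - m) ^ r \<le> fact n" using Suc by simp
  finally show ?case .
qed simp

lemma card_subsets_le_power:
  assumes "finite A"
  shows "card {B. B \<subseteq> A \<and> card B \<le> m} \<le> (card A + 1) ^ m"
proof -
  have "{B. B \<subseteq> A \<and> card B \<le> m} = (\<Union>i\<le>m. {B. B \<subseteq> A \<and> card B = i})" by auto
  then have "card {B. B \<subseteq> A \<and> card B \<le> m} \<le> (\<Sum>i\<le>m. card {B. B \<subseteq> A \<and> card B = i})"
    by (simp add: card_UN_le)
  also have "\<dots> = (\<Sum>i\<le>m. card A choose i)" by (simp add: n_subsets[OF assms])
  also have "\<dots> \<le> (\<Sum>i\<le>m. (m choose i) * card A ^ i)"
  proof (rule sum_mono)
    fix i assume "i \<in> {..m}"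
    then have "1 \<le> m choose i" by (simp add: Suc_leI)
    moreover have "card A choose i \<le> card A ^ i"
      by (cases "i \<le> card A") (simp_all add: binomial_le_pow binomial_eq_0)
    ultimately show "card A choose i \<le> (m choose i) * card A ^ i"
      using mult_le_mono by fastforce
  qed
  also have "\<dots> = (card A + 1) ^ m" using binomial_ring[of "card A" 1 m] by simp
  finally show ?thesis .
qed

lemma card_le_agree_outside:
  assumes "finite W" "finite \<G>" "\<And>X. X \<in> \<B> \<Longrightarrow> \<exists>Y\<in>\<G>. Y - W = X - W"
  shows "card \<B> \<le> 2 ^ card W * card \<G>"
proof -
  have "\<B> \<subseteq> (\<lambda>(Y, Z). (Y - W) \<union> Z) ` (\<G> \<times> Pow W)"
  proof
    fix X assume "X \<in> \<B>"
    then obtain Y where Y: "Y \<in> \<G>" "Y - W = X - W" using assms(3) by blast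
    then have "X = (Y - W) \<union> (X \<inter> W)" by blast
    with Y(1) show "X \<in> (\<lambda>(Y, Z). (Y - W) \<union> Z) ` (\<G> \<times> Pow W)"
      by (intro image_eqI[of _ _ "(Y, X \<inter> W)"]) auto
  qed
  then have "card \<B> \<le> card (\<G> \<times> Pow W)" using assms(1,2) by (intro surj_card_le) auto
  then show ?thesis using assms(1) by (simp add: card_cartesian_product card_Pow mult.commute)
qed

section \<open>Sunflowers\<close>

definition sunflower :: "'a set \<Rightarrow> 'a set set \<Rightarrow> bool" where
  "sunflower K \<S> \<longleftrightarrow> (\<forall>A\<in>\<S>. K \<subseteq> A) \<and> pairwise (\<lambda>A B. A \<inter> B \<subseteq> K) \<S>"

lemma sunflower_empty_core: "sunflower {} \<S> \<longleftrightarrow> pairwise disjnt \<S>"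
  by (simp add: sunflower_def pairwise_def disjnt_def)

lemma sunflower_subset: "sunflower K \<S> \<Longrightarrow> \<S>' \<subseteq> \<S> \<Longrightarrow> sunflower K \<S>'"
  unfolding sunflower_def by (blast intro: pairwise_subset)

lemma sunflower_core_psubset:
  assumes "sunflower K \<S>" "A \<in> \<S>" "B \<in> \<S>" "A \<noteq> B" "finite B" "card A = card B"
  shows "K \<subset> A"
proof -
  have "K \<subseteq> A" "K \<subseteq> B" using assms(1-3) by (auto simp: sunflower_def)
  moreover have "K \<noteq> A" using card_subset_eq[OF assms(5) _ assms(6)] \<open>K \<subseteq> B\<close> assms(4) by blast
  ultimately show ?thesis by blast
qed

lemma card_petals_meeting_le:
  assumes "sunflower K \<S>" "finite I" "\<And>A. A \<in> \<S> \<Longrightarrow> (A - K) \<inter> I \<noteq> {}"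
  shows "card \<S> \<le> card I"
proof -
  obtain f where f: "\<And>A. A \<in> \<S> \<Longrightarrow> f A \<in> (A - K) \<inter> I"
    using bchoice[of \<S> "\<lambda>A x. x \<in> (A - K) \<inter> I"] assms(3) by blast
  have "inj_on f \<S>"
  proof (rule inj_onI, rule ccontr)
    fix A B assume "A \<in> \<S>" "B \<in> \<S>" "f A = f B" "A \<noteq> B"
    then have "f A \<in> A \<inter> B - K" using f by fastforce
    then show False
      using assms(1) \<open>A \<in> \<S>\<close> \<open>B \<in> \<S>\<close> \<open>A \<noteq> B\<close> unfolding sunflower_def pairwise_def by blast
  qed
  then show ?thesis using f assms(2) by (intro card_inj_on_le) blast+
qed

lemma maximal_disjoint_subfamily:
  assumes "finite \<F>"
  obtains \<D> where "\<D> \<subseteq> \<F>" "pairwise disjnt \<D>" "\<And>A. A \<in> \<F> \<Longrightarrow> A \<noteq> {} \<Longrightarrow> A \<inter> \<Union>\<D> \<noteq> {}"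
proof -
  define \<Phi> where "\<Phi> = {\<D>. \<D> \<subseteq> \<F> \<and> pairwise disjnt \<D>}"
  have "finite \<Phi>" using assms by (simp add: \<Phi>_def)
  then have "\<exists>\<D>\<in>\<Phi>. \<forall>\<D>'\<in>\<Phi>. \<D> \<subseteq> \<D>' \<longrightarrow> \<D> = \<D>'"
    by (rule finite_has_maximal) (use pairwise_empty \<Phi>_def in blast)
  then obtain \<D> where \<D>: "\<D> \<in> \<Phi>"
    and maximal: "\<And>\<D>'. \<D>' \<in> \<Phi> \<Longrightarrow> \<D> \<subseteq> \<D>' \<Longrightarrow> \<D> = \<D>'" by metis
  show ?thesis
  proof (rule that)
    fix A assume A: "A \<in> \<F>" "A \<noteq> {}"
    show "A \<inter> \<Union>\<D> \<noteq> {}"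
    proof
      assume disjoint: "A \<inter> \<Union>\<D> = {}"
      then have "insert A \<D> \<in> \<Phi>" using A(1) \<D> by (auto simp: \<Phi>_def pairwise_insert disjnt_def)
      then have "A \<in> \<D>" using maximal by blast
      with A(2) disjoint show False by blast
    qed
  qed (use \<D> in \<open>simp_all add: \<Phi>_def\<close>)
qed

lemma common_element:
  assumes "finite \<F>" "finite Z" "\<And>A. A \<in> \<F> \<Longrightarrow> A \<inter> Z \<noteq> {}" "card Z * c < card \<F>"
  obtains z where "c < card {A \<in> \<F>. z \<in> A}"
proof -
  obtain f where f: "\<And>A. A \<in> \<F> \<Longrightarrow> f A \<in> A \<inter> Z"
    using bchoice[of \<F> "\<lambda>A x. x \<in> A \<inter> Z"] assms(3) by blast
  have "f \<in> \<F> \<rightarrow> Z" using f by blast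
  moreover have "Z \<noteq> {}"
    using assms(3,4) by (metis all_not_in_conv card.empty inf_bot_right not_less_zero)
  ultimately obtain z where z: "card \<F> \<le> card (f -` {z} \<inter> \<F>) * card Z"
    using pigeonhole_card assms(1,2) by blast
  have "card Z * c < card (f -` {z} \<inter> \<F>) * card Z" using assms(4) z by (rule less_le_trans)
  then have "c < card (f -` {z} \<inter> \<F>)" by (simp add: mult.commute)
  also have "\<dots> \<le> card {A \<in> \<F>. z \<in> A}" using f assms(1) by (intro card_mono) auto
  finally show ?thesis by (rule that)
qed

lemma disjoint_subfamily_or_common_element:
  assumes "finite \<F>" "\<And>A. A \<in> \<F> \<Longrightarrow> finite A \<and> card A = s" "0 < s" "s * p \<le> M" "M * c < card \<F>"
  shows "(\<exists>\<D>\<subseteq>\<F>. card \<D> = p \<and> pairwise disjnt \<D>) \<or> (\<exists>z. c < card {A \<in> \<F>. z \<in> A})"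
proof -
  obtain \<D> where \<D>: "\<D> \<subseteq> \<F>" "pairwise disjnt \<D>" "\<And>A. A \<in> \<F> \<Longrightarrow> A \<noteq> {} \<Longrightarrow> A \<inter> \<Union>\<D> \<noteq> {}"
    using maximal_disjoint_subfamily[OF assms(1)] by blast
  show ?thesis
  proof (cases "p \<le> card \<D>")
    case True
    then obtain \<D>' where "\<D>' \<subseteq> \<D>" "card \<D>' = p" by (meson obtain_subset_with_card_n)
    moreover from this have "\<D>' \<subseteq> \<F>" "pairwise disjnt \<D>'"
      using \<D>(1,2) pairwise_subset by blast+
    ultimately show ?thesis by blast
  next
    case False
    have fin: "finite (\<Union>\<D>)" using \<D>(1) assms(1,2) by (auto intro: finite_subset)
    have "card (\<Union>\<D>) \<le> (\<Sum>A\<in>\<D>. card A)" by (rule card_Union_le_sum_card)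
    also have "\<dots> = card \<D> * s" using \<D>(1) assms(2) by (simp add: subset_iff)
    also have "\<dots> \<le> p * s" using False by (intro mult_le_mono) auto
    finally have "card (\<Union>\<D>) * c \<le> M * c" using assms(4) by (simp add: mult.commute)
    then have "card (\<Union>\<D>) * c < card \<F>" using assms(5) by (rule le_less_trans)
    moreover have "A \<inter> \<Union>\<D> \<noteq> {}" if "A \<in> \<F>" for A
      using \<D>(3)[OF that] assms(2)[OF that] assms(3) by force
    ultimately obtain z where "c < card {A \<in> \<F>. z \<in> A}"
      by (elim common_element[OF assms(1) fin, rotated])
    then show ?thesis by blast
  qed
qed

lemma sunflower_from_link:
  assumes "\<S> \<subseteq> (\<lambda>A. A - {z}) ` {A \<in> \<F>. z \<in> A}" "sunflower K \<S>"
  shows "insert z ` \<S> \<subseteq> \<F>" "card (insert z ` \<S>) = card \<S>" "sunflower (insert z K) (insert z ` \<S>)"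
proof -
  show "insert z ` \<S> \<subseteq> \<F>" using assms(1) by (auto simp: insert_absorb)
  have "inj_on (insert z) \<S>" using assms(1) by (intro inj_onI) blast
  then show "card (insert z ` \<S>) = card \<S>" by (rule card_image)
  show "sunflower (insert z K) (insert z ` \<S>)"
    using assms(2) unfolding sunflower_def pairwise_def by blast
qed

theorem sunflower_lemma:
  assumes "finite \<F>" "\<And>A. A \<in> \<F> \<Longrightarrow> finite A \<and> card A = s" "s * p \<le> M" "M ^ s < card \<F>"
  shows "\<exists>\<S> K. \<S> \<subseteq> \<F> \<and> card \<S> = p \<and> sunflower K \<S>"
  using assms
proof (induction s arbitrary: \<F>)
  case 0
  have "A = {}" if "A \<in> \<F>" for A using 0(2)[OF that] by auto
  then have "\<F> \<subseteq> {{}}" by blast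
  then have "card \<F> \<le> 1" using card_mono[of "{{}}" \<F>] by simp
  with 0 show ?case by simp
next
  case (Suc s)
  have "M * M ^ s < card \<F>" using Suc.prems(4) by simp
  then consider (disjoint) \<D> where "\<D> \<subseteq> \<F>" "card \<D> = p" "pairwise disjnt \<D>"
    | (common) z where "M ^ s < card {A \<in> \<F>. z \<in> A}"
    using disjoint_subfamily_or_common_element[OF Suc.prems(1,2) _ Suc.prems(3)] by blast
  then show ?case
  proof cases
    case disjoint
    then show ?thesis using sunflower_empty_core by metis
  next
    case common
    let ?link = "(\<lambda>A. A - {z}) ` {A \<in> \<F>. z \<in> A}"
    have "\<exists>\<S> K. \<S> \<subseteq> ?link \<and> card \<S> = p \<and> sunflower K \<S>"
    proof (rule Suc.IH)
      have "inj_on (\<lambda>A. A - {z}) {A \<in> \<F>. z \<in> A}" by (rule inj_onI) blast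
      then show "M ^ s < card ?link" using common by (simp add: card_image)
    qed (use Suc.prems in auto)
    then obtain \<S> K where \<S>: "\<S> \<subseteq> ?link" "card \<S> = p" "sunflower K \<S>" by blast
    then show ?thesis using sunflower_from_link[OF \<S>(1,3)] by metis
  qed
qed

section \<open>Closure under approximate covers\<close>

definition cover_closed :: "'t set \<Rightarrow> ('t \<Rightarrow> 'x set) \<Rightarrow> real \<Rightarrow> 't set \<Rightarrow> bool" where
  "cover_closed \<M> ev \<delta> \<C> \<longleftrightarrow> (\<forall>K\<in>\<M>. real (card (ev K - \<Union>(ev ` \<C>))) \<le> \<delta> \<longrightarrow> K \<in> \<C>)"

lemma cover_closure:
  assumes "finite \<M>" "\<T> \<subseteq> \<M>" "0 \<le> \<delta>"
  obtains \<C> where "\<T> \<subseteq> \<C>" "\<C> \<subseteq> \<M>" "cover_closed \<M> ev \<delta> \<C>"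
    "real (card (\<Union>(ev ` \<C>) - \<Union>(ev ` \<T>))) \<le> \<delta> * card \<M>"
proof -
  define error where "error \<C> = \<Union>(ev ` \<C>) - \<Union>(ev ` \<T>)" for \<C>
  define \<Phi> where "\<Phi> = {\<C>. \<C> \<subseteq> \<M> \<and> real (card (error \<C>)) \<le> \<delta> * card \<C>}"
  have "finite \<Phi>" using assms(1) by (simp add: \<Phi>_def)
  moreover have "\<T> \<in> \<Phi>" using assms(2,3) by (simp add: \<Phi>_def error_def)
  ultimately have "\<exists>\<C>\<in>\<Phi>. \<T> \<subseteq> \<C> \<and> (\<forall>\<C>'\<in>\<Phi>. \<C> \<subseteq> \<C>' \<longrightarrow> \<C> = \<C>')"
    by (rule finite_has_maximal2)
  then obtain \<C> where \<C>: "\<C> \<in> \<Phi>" "\<T> \<subseteq> \<C>"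
    and maximal: "\<And>\<C>'. \<C>' \<in> \<Phi> \<Longrightarrow> \<C> \<subseteq> \<C>' \<Longrightarrow> \<C> = \<C>'" by metis
  have fin: "finite \<C>" using \<C>(1) assms(1) by (auto simp: \<Phi>_def intro: finite_subset)
  have "cover_closed \<M> ev \<delta> \<C>"
    unfolding cover_closed_def
  proof (intro ballI impI, rule ccontr)
    fix K assume K: "K \<in> \<M>" "real (card (ev K - \<Union>(ev ` \<C>))) \<le> \<delta>" "K \<notin> \<C>"
    have "error (insert K \<C>) = error \<C> \<union> (ev K - \<Union>(ev ` \<C>))"
      using \<C>(2) by (auto simp: error_def)
    then have "real (card (error (insert K \<C>))) \<le> real (card (error \<C>)) + real (card (ev K - \<Union>(ev ` \<C>)))"
      using card_Un_le[of "error \<C>" "ev K - \<Union>(ev ` \<C>)"] by simp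
    also have "\<dots> \<le> \<delta> * card \<C> + \<delta>" using \<C>(1) K(2) by (intro add_mono) (simp_all add: \<Phi>_def)
    also have "\<dots> = \<delta> * card (insert K \<C>)" using K(3) fin by (simp add: algebra_simps)
    finally have "insert K \<C> \<in> \<Phi>" using \<C>(1) K(1) by (simp add: \<Phi>_def)
    then show False using maximal K(3) by blast
  qed
  moreover have "real (card (error \<C>)) \<le> \<delta> * card \<M>"
  proof -
    have "card \<C> \<le> card \<M>" using \<C>(1) assms(1) by (auto simp: \<Phi>_def intro: card_mono)
    then have "\<delta> * card \<C> \<le> \<delta> * card \<M>" using assms(3) by (intro mult_left_mono) auto
    then show ?thesis using \<C>(1) by (simp add: \<Phi>_def)
  qed
  ultimately show ?thesis using \<C> that by (simp add: \<Phi>_def error_def)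
qed

section \<open>Matchings and 2-colourings\<close>

definition matching :: "('a \<times> 'b) set \<Rightarrow> bool" where
  "matching T \<longleftrightarrow> finite T \<and> inj_on fst T \<and> inj_on snd T"

definition ends :: "('a \<times> 'b) set \<Rightarrow> ('a + 'b) set" where
  "ends T = fst ` T <+> snd ` T"

definition monochrom :: "('a + 'b) set \<Rightarrow> ('a \<times> 'b) set" where
  "monochrom X = {(i, j). Inl i \<in> X \<longleftrightarrow> Inr j \<in> X}"

definition colourings :: "('a + 'b) set \<Rightarrow> ('a \<times> 'b) set \<Rightarrow> ('a + 'b) set set" where
  "colourings U T = {X \<in> Pow U. T \<subseteq> monochrom X}"

lemma matching_subset: "matching T \<Longrightarrow> S \<subseteq> T \<Longrightarrow> matching S"
  unfolding matching_def by (meson finite_subset inj_on_subset)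

lemma mem_endsI: "(i, j) \<in> T \<Longrightarrow> Inl i \<in> ends T" "(i, j) \<in> T \<Longrightarrow> Inr j \<in> ends T"
  by (force simp: ends_def)+

lemma finite_ends: "matching T \<Longrightarrow> finite (ends T)"
  by (simp add: matching_def ends_def)

lemma card_ends: "matching T \<Longrightarrow> card (ends T) = 2 * card T"
  by (simp add: matching_def ends_def card_Plus card_image)

lemma monochrom_cong:
  assumes "\<And>v. v \<in> ends T \<Longrightarrow> v \<in> X \<longleftrightarrow> v \<in> Y"
  shows "T \<subseteq> monochrom X \<longleftrightarrow> T \<subseteq> monochrom Y"
proof -
  have "(i, j) \<in> monochrom X \<longleftrightarrow> (i, j) \<in> monochrom Y" if "(i, j) \<in> T" for i j
    using assms mem_endsI[OF that] by (simp add: monochrom_def)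
  then show ?thesis by auto
qed

lemma recolour_matching:
  assumes "matching T" "\<And>i j. (i, j) \<in> T \<Longrightarrow> Inl i \<in> W \<or> Inr j \<in> W"
  obtains Y where "Y - W = X - W" "Y \<subseteq> X \<union> W" "T \<subseteq> monochrom Y"
proof
  let ?Y = "(X - W) \<union> {Inl i | i j. (i, j) \<in> T \<and> Inl i \<in> W \<and> Inr j \<in> X - W}
    \<union> {Inr j | i j. (i, j) \<in> T \<and> Inr j \<in> W \<and> Inl i \<in> X - W}"
  show "?Y - W = X - W" "?Y \<subseteq> X \<union> W" by auto
  show "T \<subseteq> monochrom ?Y"
  proof clarify
    fix i j assume ij: "(i, j) \<in> T"
    have partner: "i' = i \<longleftrightarrow> j' = j" if "(i', j') \<in> T" for i' j'
      using that ij assms(1) unfolding matching_def inj_on_def by fastforce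
    have "Inl i \<in> ?Y \<longleftrightarrow> (if Inl i \<in> W then Inr j \<in> X - W else Inl i \<in> X)"
      using ij partner by auto
    moreover have "Inr j \<in> ?Y \<longleftrightarrow> (if Inr j \<in> W then Inl i \<in> X - W else Inr j \<in> X)"
      using ij partner by auto
    ultimately show "(i, j) \<in> monochrom ?Y"
      using assms(2)[OF ij] unfolding monochrom_def by (simp split: if_splits)
  qed
qed

lemma card_le_card_monochrom:
  assumes "matching T" "\<And>i j. (i, j) \<in> T \<Longrightarrow> Inl i \<in> W \<or> Inr j \<in> W"
    and "finite W" "finite \<B>"
    and closed: "\<And>X Y. X \<in> \<B> \<Longrightarrow> Y - W = X - W \<Longrightarrow> Y \<subseteq> X \<union> W \<Longrightarrow> Y \<in> \<B>"
  shows "card \<B> \<le> 2 ^ card W * card {X \<in> \<B>. T \<subseteq> monochrom X}"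
proof (rule card_le_agree_outside)
  fix X assume X: "X \<in> \<B>"
  obtain Y where "Y - W = X - W" "Y \<subseteq> X \<union> W" "T \<subseteq> monochrom Y"
    using recolour_matching[OF assms(1,2)] .
  then show "\<exists>Y\<in>{X \<in> \<B>. T \<subseteq> monochrom X}. Y - W = X - W"
    using closed[OF X] by (intro bexI[of _ Y]) simp_all
qed (use assms in simp_all)

lemma card_odd_colourings_ge:
  assumes "finite U" "matching T" "ends T \<subset> U"
  shows "2 ^ card U \<le> 2 ^ (2 * card T + 1) * card {X \<in> colourings U T. odd (card X)}"
proof -
  obtain v where v: "v \<in> U" "v \<notin> ends T" using assms(3) by blast
  define adjust where "adjust X = (if odd (card X) then X else insert v X)" for X
  have "card (Pow (U - {v})) \<le> 2 ^ card (ends T) * card {X \<in> Pow (U - {v}). T \<subseteq> monochrom X}"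
    using assms(2,3) v by (intro card_le_card_monochrom) (auto simp: finite_ends mem_endsI assms(1))
  also have "card {X \<in> Pow (U - {v}). T \<subseteq> monochrom X} \<le> card {X \<in> colourings U T. odd (card X)}"
  proof (rule card_inj_on_le)
    show "inj_on adjust {X \<in> Pow (U - {v}). T \<subseteq> monochrom X}"
      by (rule inj_onI) (auto simp: adjust_def split: if_splits)
    have "odd (card (insert v X))" if "X \<subseteq> U - {v}" "even (card X)" for X
    proof -
      have "finite X" "v \<notin> X" using that(1) assms(1) finite_subset by auto
      then show ?thesis using that(2) by simp
    qed
    moreover have "T \<subseteq> monochrom (insert v X) \<longleftrightarrow> T \<subseteq> monochrom X" for X
      using v(2) by (intro monochrom_cong) auto
    ultimately show "adjust ` {X \<in> Pow (U - {v}). T \<subseteq> monochrom X} \<subseteq> {X \<in> colourings U T. odd (card X)}"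
      using v(1) by (auto simp: adjust_def colourings_def)
    show "finite {X \<in> colourings U T. odd (card X)}" using assms(1) by (simp add: colourings_def)
  qed
  finally have "2 ^ (card U - 1) \<le> 2 ^ (2 * card T) * card {X \<in> colourings U T. odd (card X)}"
    using assms(1,2) v(1) by (simp add: card_Pow card_ends)
  moreover have "(2::nat) ^ card U = 2 * 2 ^ (card U - 1)"
    using assms(1) v(1) by (cases "card U") auto
  ultimately show ?thesis by simp
qed

section \<open>Sunflowers of matchings\<close>

definition edges_within :: "('a + 'b) set \<Rightarrow> ('a \<times> 'b) set" where
  "edges_within Y = {(i, j). Inl i \<in> Y \<and> Inr j \<in> Y}"

definition avoiding :: "('a + 'b) set \<Rightarrow> ('a \<times> 'b) set \<Rightarrow> ('a \<times> 'b) set set \<Rightarrow> ('a + 'b) set set" where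
  "avoiding U K \<S> = {X \<in> Pow U. \<forall>T\<in>\<S>. \<not> T - K \<subseteq> monochrom X}"

text \<open>Once the colours of \<open>Y\<close> are fixed, the events \<open>T - K \<subseteq> monochrom X\<close> depend on
  disjoint sets of vertices.\<close>

definition independent_petals :: "('a \<times> 'b) set \<Rightarrow> ('a + 'b) set \<Rightarrow> ('a \<times> 'b) set set \<Rightarrow> bool" where
  "independent_petals K Y \<S> \<longleftrightarrow>
     (\<forall>T\<in>\<S>. (T - K) \<inter> edges_within Y = {}) \<and>
     pairwise (\<lambda>T T'. ends T \<inter> ends T' \<subseteq> Y) \<S>"

lemma card_avoiding_le_card_meeting:
  assumes "finite U" "matching T" "ends T \<subseteq> U" "T \<notin> \<S>" "independent_petals K Y (insert T \<S>)"
  shows "card (avoiding U K \<S>) \<le> 2 ^ (2 * card T) * card {X \<in> avoiding U K \<S>. T - K \<subseteq> monochrom X}"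
proof -
  let ?W = "ends T - Y"
  have "card (avoiding U K \<S>) \<le> 2 ^ card ?W * card {X \<in> avoiding U K \<S>. T - K \<subseteq> monochrom X}"
  proof (rule card_le_card_monochrom)
    show "matching (T - K)" using assms(2) by (rule matching_subset) blast
    show "Inl i \<in> ?W \<or> Inr j \<in> ?W" if "(i, j) \<in> T - K" for i j
    proof -
      have "(i, j) \<notin> edges_within Y" using that assms(5) by (auto simp: independent_petals_def)
      then show ?thesis using that mem_endsI[of i j T] by (auto simp: edges_within_def)
    qed
    fix X Z assume X: "X \<in> avoiding U K \<S>" and Z: "Z - ?W = X - ?W" "Z \<subseteq> X \<union> ?W"
    have "S - K \<subseteq> monochrom Z \<longleftrightarrow> S - K \<subseteq> monochrom X" if "S \<in> \<S>" for S
    proof (rule monochrom_cong)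
      fix v assume "v \<in> ends (S - K)"
      then have "v \<in> ends S" by (auto simp: ends_def)
      moreover have "ends T \<inter> ends S \<subseteq> Y"
        using that assms(4,5) by (auto simp: independent_petals_def pairwise_insert)
      ultimately have "v \<notin> ?W" by blast
      then show "v \<in> Z \<longleftrightarrow> v \<in> X" using Z(1) by blast
    qed
    then show "Z \<in> avoiding U K \<S>" using X Z(2) assms(3) unfolding avoiding_def by blast
  qed (use assms(1,2) in \<open>simp_all add: finite_ends avoiding_def\<close>)
  also have "\<dots> \<le> 2 ^ (2 * card T) * card {X \<in> avoiding U K \<S>. T - K \<subseteq> monochrom X}"
    using card_mono[OF finite_ends[OF assms(2)], of ?W] card_ends[OF assms(2)]
    by (intro mult_le_mono1 power_increasing) auto
  finally show ?thesis .
qed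

lemma card_avoiding_petals_le:
  assumes "finite U" "finite \<S>" "\<And>T. T \<in> \<S> \<Longrightarrow> matching T \<and> ends T \<subseteq> U \<and> card T \<le> m"
    and "independent_petals K Y \<S>"
  shows "real (card (avoiding U K \<S>)) \<le> (1 - 1 / 2 ^ (2 * m)) ^ card \<S> * 2 ^ card U"
  using assms(2-)
proof (induction \<S>)
  case empty
  then show ?case using assms(1) by (simp add: avoiding_def card_Pow flip: Pow_def)
next
  case (insert T \<S>)
  let ?meeting = "{X \<in> avoiding U K \<S>. T - K \<subseteq> monochrom X}"
  have fin: "finite (avoiding U K \<S>)" using assms(1) by (simp add: avoiding_def)
  have "card (avoiding U K \<S>) \<le> 2 ^ (2 * card T) * card ?meeting"
    using insert.prems insert.hyps assms(1) by (intro card_avoiding_le_card_meeting[where Y = Y]) auto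
  also have "\<dots> \<le> 2 ^ (2 * m) * card ?meeting"
    using insert.prems(1) by (intro mult_le_mono1 power_increasing) auto
  finally have "real (card (avoiding U K \<S>)) \<le> real (2 ^ (2 * m) * card ?meeting)" by (rule of_nat_mono)
  then have meeting: "real (card (avoiding U K \<S>)) / 2 ^ (2 * m) \<le> real (card ?meeting)"
    by (simp add: divide_le_eq mult.commute)
  have "avoiding U K (insert T \<S>) = avoiding U K \<S> - ?meeting" by (auto simp: avoiding_def)
  then have "real (card (avoiding U K (insert T \<S>)))
      = real (card (avoiding U K \<S>)) - real (card ?meeting)"
    using fin by (simp add: card_Diff_subset card_mono of_nat_diff)
  also have "\<dots> \<le> (1 - 1 / 2 ^ (2 * m)) * real (card (avoiding U K \<S>))"
    using meeting by (simp add: algebra_simps)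
  also have "\<dots> \<le> (1 - 1 / 2 ^ (2 * m)) * ((1 - 1 / 2 ^ (2 * m)) ^ card \<S> * 2 ^ card U)"
    using insert.IH insert.prems
    by (intro mult_left_mono) (auto simp: independent_petals_def pairwise_insert)
  finally show ?case using insert.hyps by (simp add: mult.assoc)
qed

text \<open>A sunflower of edge sets would still allow its petals to share vertices, so the
  vertices are made elements of the sets as well.\<close>

lemma matching_sunflower:
  assumes "finite \<S>" "\<And>T. T \<in> \<S> \<Longrightarrow> matching T \<and> card T = r" "3 * r * q \<le> M" "M ^ (3 * r) < card \<S>"
  obtains \<Q> K Y where "\<Q> \<subseteq> \<S>" "card \<Q> = q" "sunflower K \<Q>"
    "\<forall>T\<in>\<Q>. Y \<subseteq> ends T" "pairwise (\<lambda>T T'. ends T \<inter> ends T' \<subseteq> Y) \<Q>"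
proof -
  define tokens :: "('a \<times> 'b) set \<Rightarrow> (('a \<times> 'b) + ('a + 'b)) set"
    where "tokens T = T <+> ends T" for T
  have mem_tokens: "Inl e \<in> tokens T \<longleftrightarrow> e \<in> T" "Inr v \<in> tokens T \<longleftrightarrow> v \<in> ends T" for e v T
    by (auto simp: tokens_def)
  have inj: "inj tokens" by (rule injI) (metis mem_tokens(1) set_eqI)
  have "\<exists>\<B> C. \<B> \<subseteq> tokens ` \<S> \<and> card \<B> = q \<and> sunflower C \<B>"
  proof (rule sunflower_lemma)
    fix A assume "A \<in> tokens ` \<S>"
    then obtain T where "T \<in> \<S>" "A = tokens T" by blast
    then show "finite A \<and> card A = 3 * r"
      using assms(2)[of T] by (simp add: tokens_def finite_ends card_Plus card_ends matching_def)
  qed (use assms in \<open>simp_all add: card_image inj_on_subset[OF inj]\<close>)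
  then obtain \<Q> C where \<Q>: "\<Q> \<subseteq> \<S>" "card (tokens ` \<Q>) = q" "sunflower C (tokens ` \<Q>)"
    by (metis subset_image_iff)
  let ?K = "{e. Inl e \<in> C}" and ?Y = "{v. Inr v \<in> C}"
  have core: "?K \<subseteq> T" "?Y \<subseteq> ends T" if "T \<in> \<Q>" for T
  proof -
    have "C \<subseteq> tokens T" using \<Q>(3) that by (simp add: sunflower_def)
    then show "?K \<subseteq> T" "?Y \<subseteq> ends T" by (auto simp: tokens_def)
  qed
  have common: "T \<inter> T' \<subseteq> ?K" "ends T \<inter> ends T' \<subseteq> ?Y" if "T \<in> \<Q>" "T' \<in> \<Q>" "T \<noteq> T'" for T T'
  proof -
    have "pairwise (\<lambda>A B. A \<inter> B \<subseteq> C) (tokens ` \<Q>)" using \<Q>(3) by (simp add: sunflower_def)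
    then have "tokens T \<inter> tokens T' \<subseteq> C"
      using that inj by (auto simp: pairwise_image pairwise_def inj_eq)
    then show "T \<inter> T' \<subseteq> ?K" "ends T \<inter> ends T' \<subseteq> ?Y" by (auto simp: tokens_def)
  qed
  have "sunflower ?K \<Q>" using core(1) common(1) by (simp add: sunflower_def pairwise_def)
  moreover have "pairwise (\<lambda>T T'. ends T \<inter> ends T' \<subseteq> ?Y) \<Q>" using common(2) by (simp add: pairwise_def)
  moreover have "card \<Q> = q" using \<Q>(2) by (simp add: card_image inj_on_subset[OF inj])
  ultimately show ?thesis using \<Q>(1) core(2) that by metis
qed

lemma card_edges_within_ends_le:
  assumes "matching T" "Y \<subseteq> ends T"
  shows "finite (edges_within Y)" "card (edges_within Y) \<le> (card T)\<^sup>2"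
proof -
  have within: "edges_within Y \<subseteq> fst ` T \<times> snd ` T"
    using assms(2) by (auto simp: edges_within_def ends_def)
  have fin: "finite (fst ` T \<times> snd ` T)" using assms(1) by (simp add: matching_def)
  show "finite (edges_within Y)" by (rule finite_subset[OF within fin])
  have "card (edges_within Y) \<le> card (fst ` T \<times> snd ` T)" by (rule card_mono[OF fin within])
  then show "card (edges_within Y) \<le> (card T)\<^sup>2"
    using assms(1) by (simp add: card_cartesian_product card_image matching_def power2_eq_square)
qed

text \<open>The petals with a private edge inside \<open>Y\<close> have to be discarded; there are at most
  \<open>r\<^sup>2\<close> such edges.\<close>

lemma independent_petals_exist:
  assumes "finite \<S>" "\<And>T. T \<in> \<S> \<Longrightarrow> matching T \<and> card T = r" "2 \<le> p"
    "3 * r * (p + r\<^sup>2) \<le> M" "M ^ (3 * r) < card \<S>"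
  obtains \<P> K Y where "\<P> \<subseteq> \<S>" "p \<le> card \<P>" "independent_petals K Y \<P>" "\<forall>T\<in>\<P>. K \<subset> T"
proof -
  obtain \<Q> K Y where \<Q>: "\<Q> \<subseteq> \<S>" "card \<Q> = p + r\<^sup>2" "sunflower K \<Q>"
    and Y: "\<forall>T\<in>\<Q>. Y \<subseteq> ends T" "pairwise (\<lambda>T T'. ends T \<inter> ends T' \<subseteq> Y) \<Q>"
    using matching_sunflower[OF assms(1,2,4,5)] .
  have fin: "finite \<Q>" using \<Q>(1) assms(1) by (rule finite_subset)
  define bad where "bad = {T \<in> \<Q>. (T - K) \<inter> edges_within Y \<noteq> {}}"
  have "\<Q> \<noteq> {}" using \<Q>(2) assms(3) by auto
  then obtain S where "S \<in> \<Q>" by blast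
  then have inner: "finite (edges_within Y)" "card (edges_within Y) \<le> r\<^sup>2"
    using card_edges_within_ends_le[of S Y] Y(1) assms(2) \<Q>(1) by blast+
  have "sunflower K bad" using \<Q>(3) by (rule sunflower_subset) (simp add: bad_def)
  then have "card bad \<le> card (edges_within Y)"
    using inner(1) by (rule card_petals_meeting_le) (simp add: bad_def)
  then have "p \<le> card \<Q> - card bad" using inner(2) \<Q>(2) by simp
  also have "\<dots> = card (\<Q> - bad)" using fin by (intro card_Diff_subset[symmetric]) (auto simp: bad_def)
  finally have "p \<le> card (\<Q> - bad)" .
  moreover have "independent_petals K Y (\<Q> - bad)"
    using Y(2) unfolding independent_petals_def by (auto simp: bad_def intro: pairwise_subset)
  moreover have "K \<subset> T" if T: "T \<in> \<Q> - bad" for T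
  proof -
    have "\<Q> \<noteq> {T}" using \<Q>(2) assms(3) by auto
    then obtain T' where T': "T' \<in> \<Q>" "T \<noteq> T'" using T by blast
    then have "matching T'" "card T = card T'" using T assms(2) \<Q>(1) by blast+
    then show ?thesis using T T' by (intro sunflower_core_psubset[OF \<Q>(3)]) (auto simp: matching_def)
  qed
  ultimately show ?thesis using \<Q>(1) that by blast
qed

section \<open>Minimal members of closed families\<close>

definition matchings :: "'a set \<Rightarrow> nat \<Rightarrow> ('a \<times> 'a) set set" where
  "matchings V m = {T. matching T \<and> T \<subseteq> V \<times> V \<and> card T \<le> m}"

definition minimal_members :: "'a set set \<Rightarrow> 'a set set" where
  "minimal_members \<C> = {T \<in> \<C>. \<forall>S\<in>\<C>. \<not> S \<subset> T}"

lemma minimal_member_below: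
  assumes "finite \<C>" "S \<in> \<C>"
  obtains T where "T \<in> minimal_members \<C>" "T \<subseteq> S"
  using finite_has_minimal2[OF assms] unfolding minimal_members_def psubset_eq by blast

lemma finite_matchings: "finite V \<Longrightarrow> finite (matchings V m)"
  by (rule finite_subset[of _ "Pow (V \<times> V)"]) (auto simp: matchings_def)

lemma card_matchings_le:
  assumes "finite V" shows "card (matchings V m) \<le> ((card V)\<^sup>2 + 1) ^ m"
proof -
  have "card (matchings V m) \<le> card {T. T \<subseteq> V \<times> V \<and> card T \<le> m}"
    using assms by (intro card_mono) (auto simp: matchings_def)
  also have "\<dots> \<le> ((card V)\<^sup>2 + 1) ^ m"
    using card_subsets_le_power[of "V \<times> V" m] assms
    by (simp add: card_cartesian_product power2_eq_square)
  finally show ?thesis .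
qed

lemma matchings_subset:
  assumes "T \<in> matchings V m" "S \<subseteq> T"
  shows "S \<in> matchings V m"
proof -
  have "card S \<le> card T" using assms by (auto simp: matchings_def matching_def intro: card_mono)
  then show ?thesis using assms unfolding matchings_def by (auto intro: matching_subset)
qed

lemma ends_matchings: "T \<in> matchings V m \<Longrightarrow> ends T \<subseteq> V <+> V"
  by (auto simp: matchings_def ends_def)

lemma card_colourings_not_covered_le:
  assumes "finite V" "\<P> \<subseteq> matchings V m" "independent_petals K Y \<P>" "p \<le> card \<P>"
  shows "real (card (colourings (V <+> V) K - \<Union>(colourings (V <+> V) ` \<P>)))
    \<le> (1 - 1 / 2 ^ (2 * m)) ^ p * 2 ^ (2 * card V)"
proof -
  let ?U = "V <+> V"
  have "colourings ?U K - \<Union>(colourings ?U ` \<P>) \<subseteq> avoiding ?U K \<P>"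
    by (auto simp: colourings_def avoiding_def)
  then have "real (card (colourings ?U K - \<Union>(colourings ?U ` \<P>)))
      \<le> real (card (avoiding ?U K \<P>))"
    using assms(1) by (intro of_nat_mono card_mono) (simp_all add: avoiding_def)
  also have "\<dots> \<le> (1 - 1 / 2 ^ (2 * m)) ^ card \<P> * 2 ^ card ?U"
  proof (rule card_avoiding_petals_le[OF _ _ _ assms(3)])
    show "finite \<P>" using assms(2) finite_matchings[OF assms(1)] by (rule finite_subset)
    show "matching T \<and> ends T \<subseteq> ?U \<and> card T \<le> m" if "T \<in> \<P>" for T
      using that assms(2) ends_matchings[of T V m] by (auto simp: matchings_def)
  qed (simp add: assms(1))
  also have "\<dots> \<le> (1 - 1 / 2 ^ (2 * m)) ^ p * 2 ^ (2 * card V)"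
    using assms(4) card_Plus[OF assms(1,1)] by (simp add: power_decreasing mult_2)
  finally show ?thesis .
qed

text \<open>Otherwise the core of a sunflower of minimal members is almost covered by its petals,
  hence a smaller member.\<close>

lemma card_minimal_members_le:
  assumes "finite V" "\<C> \<subseteq> matchings V m"
    and closed: "cover_closed (matchings V m) (colourings (V <+> V))
      ((1 - 1 / 2 ^ (2 * m)) ^ p * 2 ^ (2 * card V)) \<C>"
    and "2 \<le> p" "3 * m * (p + m\<^sup>2) \<le> M" "r \<le> m"
  shows "card {T \<in> minimal_members \<C>. card T = r} \<le> M ^ (3 * r)"
proof (rule ccontr)
  let ?\<S> = "{T \<in> minimal_members \<C>. card T = r}"
  assume "\<not> card ?\<S> \<le> M ^ (3 * r)"
  then have large: "M ^ (3 * r) < card ?\<S>" by simp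
  have members: "?\<S> \<subseteq> matchings V m" using assms(2) by (auto simp: minimal_members_def)
  have "3 * r * (p + r\<^sup>2) \<le> 3 * m * (p + m\<^sup>2)"
    using assms(6) by (intro mult_le_mono add_mono power_mono) auto
  then have M_ge: "3 * r * (p + r\<^sup>2) \<le> M" using assms(5) by simp
  have fin: "finite ?\<S>" using members finite_matchings[OF assms(1)] by (rule finite_subset)
  have uniform: "matching T \<and> card T = r" if "T \<in> ?\<S>" for T
    using that members by (auto simp: matchings_def)
  obtain \<P> K Y where \<P>: "\<P> \<subseteq> ?\<S>" "p \<le> card \<P>" "independent_petals K Y \<P>" "\<forall>T\<in>\<P>. K \<subset> T"
    using independent_petals_exist[OF fin uniform assms(4) M_ge large] .
  have \<P>_members: "\<P> \<subseteq> \<C>" "\<P> \<subseteq> matchings V m" using \<P>(1) members by (auto simp: minimal_members_def)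
  obtain T where T: "T \<in> \<P>" "K \<subset> T" using \<P>(2,4) assms(4) by fastforce
  then have K: "K \<in> matchings V m" using matchings_subset \<P>_members(2) by blast
  have "card (colourings (V <+> V) K - \<Union>(colourings (V <+> V) ` \<C>))
      \<le> card (colourings (V <+> V) K - \<Union>(colourings (V <+> V) ` \<P>))"
    using \<P>_members(1) assms(1) by (intro card_mono) (auto simp: colourings_def)
  then have "K \<in> \<C>"
    using closed K card_colourings_not_covered_le[OF assms(1) \<P>_members(2) \<P>(3,2)]
    unfolding cover_closed_def by fastforce
  then show False using \<P>(1) T unfolding minimal_members_def by blast
qed

section \<open>Permutations\<close>

definition perm_graph :: "'a set \<Rightarrow> ('a \<Rightarrow> 'a) \<Rightarrow> ('a \<times> 'a) set" where
  "perm_graph V \<pi> = (\<lambda>i. (i, \<pi> i)) ` V"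

lemma mem_perm_graph: "(i, j) \<in> perm_graph V \<pi> \<longleftrightarrow> i \<in> V \<and> j = \<pi> i"
  by (auto simp: perm_graph_def)

lemma perm_graph_subset: "\<pi> permutes V \<Longrightarrow> perm_graph V \<pi> \<subseteq> V \<times> V"
  by (auto simp: perm_graph_def permutes_in_image)

lemma matching_perm_graph: "finite V \<Longrightarrow> \<pi> permutes V \<Longrightarrow> matching (perm_graph V \<pi>)"
  using permutes_inj_on[of \<pi> V V] by (auto simp: matching_def perm_graph_def inj_on_def)

lemma card_perms_containing_matching_le:
  assumes "finite V" "matching T" "T \<subseteq> V \<times> V"
  shows "card {\<pi>. \<pi> permutes V \<and> T \<subseteq> perm_graph V \<pi>} \<le> fact (card V - card T)"
proof -
  define f where "f i = (SOME j. (i, j) \<in> T)" for i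
  have f: "(i, f i) \<in> T" if "i \<in> fst ` T" for i using that unfolding f_def by (auto intro: someI)
  have fin: "finite {\<pi>. \<pi> permutes V \<and> P \<pi>}" for P
    using finite_permutations[OF assms(1)] by (rule rev_finite_subset) blast
  have "\<pi> i = f i" if "T \<subseteq> perm_graph V \<pi>" "i \<in> fst ` T" for \<pi> i
    using f[OF that(2)] that(1) by (auto simp: perm_graph_def)
  then have "{\<pi>. \<pi> permutes V \<and> T \<subseteq> perm_graph V \<pi>} \<subseteq> {\<pi>. \<pi> permutes V \<and> (\<forall>i\<in>fst ` T. \<pi> i = f i)}"
    by auto
  then have "card {\<pi>. \<pi> permutes V \<and> T \<subseteq> perm_graph V \<pi>}
      \<le> card {\<pi>. \<pi> permutes V \<and> (\<forall>i\<in>fst ` T. \<pi> i = f i)}" by (rule card_mono[OF fin])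
  also have "\<dots> \<le> fact (card V - card (fst ` T))"
    using assms(1,3) by (intro card_permutes_extending_le) auto
  also have "card (fst ` T) = card T" using assms(2) by (simp add: card_image matching_def)
  finally show ?thesis .
qed

lemma card_perms_containing_mult_le:
  assumes "finite V" "T \<in> matchings V m" "m \<le> card V"
  shows "card {\<pi>. \<pi> permutes V \<and> T \<subseteq> perm_graph V \<pi>} * (card V - m) ^ card T \<le> fact (card V)"
proof -
  have T: "matching T" "T \<subseteq> V \<times> V" "card T \<le> m" using assms(2) by (simp_all add: matchings_def)
  have "card {\<pi>. \<pi> permutes V \<and> T \<subseteq> perm_graph V \<pi>} * (card V - m) ^ card T
      \<le> fact (card V - card T) * (card V - m) ^ card T"
    using card_perms_containing_matching_le[OF assms(1) T(1,2)] by (rule mult_le_mono1)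
  also have "\<dots> \<le> fact (card V)" using T(3) assms(3) by (rule fact_mult_power_le_fact)
  finally show ?thesis .
qed

section \<open>Monotone circuits\<close>

definition input_gates :: "('a set \<Rightarrow> bool) set" where
  "input_gates = insert (\<lambda>S. True) (range (\<lambda>x S. x \<in> S))"

definition disjunctions :: "('a set \<Rightarrow> bool) set \<Rightarrow> ('a set \<Rightarrow> bool) set" where
  "disjunctions G = (\<lambda>Z S. \<exists>g\<in>Z. g S) ` Pow G"

text \<open>Disjunctions of any fan-in are free because approximating them causes no errors.\<close>

inductive monotone_circuit :: "nat \<Rightarrow> ('a set \<Rightarrow> bool) set \<Rightarrow> bool" where
  inputs: "monotone_circuit 0 input_gates"
| disj: "monotone_circuit N G \<Longrightarrow> monotone_circuit N (disjunctions G)"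
| conj: "monotone_circuit N G \<Longrightarrow> g \<in> G \<Longrightarrow> h \<in> G \<Longrightarrow>
    monotone_circuit (Suc N) (insert (\<lambda>S. g S \<and> h S) G)"

lemma disjunctionsI:
  assumes "\<And>z. z \<in> Z \<Longrightarrow> g z \<in> G"
  shows "(\<lambda>S. \<exists>z\<in>Z. g z S) \<in> disjunctions G"
  unfolding disjunctions_def by (rule image_eqI[of _ _ "g ` Z"]) (use assms in auto)

lemma subset_disjunctions: "G \<subseteq> disjunctions G"
proof
  fix g assume "g \<in> G"
  then show "g \<in> disjunctions G" using disjunctionsI[of "{g}" "\<lambda>g. g" G] by simp
qed

lemma input_gates_subset: "monotone_circuit N G \<Longrightarrow> input_gates \<subseteq> G"
  by (induction rule: monotone_circuit.induct) (use subset_disjunctions in blast)+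

lemma monotone_circuit_mono:
  assumes "monotone_circuit N G" "N \<le> N'"
  shows "monotone_circuit N' G"
  using assms(2)
proof (induction rule: dec_induct)
  case base
  show ?case by (rule assms(1))
next
  case (step N')
  have "(\<lambda>S. True) \<in> G" using input_gates_subset[OF assms(1)] by (simp add: input_gates_def)
  then show ?case
    using monotone_circuit.conj[OF step.IH, of "\<lambda>S. True" "\<lambda>S. True"] by (simp add: insert_absorb)
qed

lemma monotone_circuit_Ball:
  assumes "finite I" "monotone_circuit N G" "h \<in> G" "\<And>i. i \<in> I \<Longrightarrow> g i \<in> G"
  shows "\<exists>G'. monotone_circuit (N + card I) G' \<and> G \<subseteq> G' \<and> (\<lambda>S. h S \<and> (\<forall>i\<in>I. g i S)) \<in> G'"
  using assms(1,4)
proof (induction I)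
  case empty
  then show ?case using assms(2,3) by auto
next
  case (insert i I)
  then obtain G' where G': "monotone_circuit (N + card I) G'" "G \<subseteq> G'"
    "(\<lambda>S. h S \<and> (\<forall>i\<in>I. g i S)) \<in> G'" by auto
  have "g i \<in> G'" using insert.prems G'(2) by blast
  from monotone_circuit.conj[OF G'(1) this G'(3)]
  have "monotone_circuit (N + card (insert i I)) (insert (\<lambda>S. g i S \<and> h S \<and> (\<forall>i\<in>I. g i S)) G')"
    using insert.hyps by simp
  moreover have "(\<lambda>S. g i S \<and> h S \<and> (\<forall>i\<in>I. g i S)) = (\<lambda>S. h S \<and> (\<forall>i\<in>insert i I. g i S))" by auto
  ultimately have "monotone_circuit (N + card (insert i I))
      (insert (\<lambda>S. h S \<and> (\<forall>i\<in>insert i I. g i S)) G')"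
    by (simp only:)
  then show ?case using G'(2) by blast
qed

lemma monotone_circuit_family_Ball:
  assumes "finite J" "monotone_circuit N G"
    and "\<And>j. j \<in> J \<Longrightarrow> finite (I j) \<and> card (I j) \<le> c"
    and "\<And>j. j \<in> J \<Longrightarrow> h j \<in> G" "\<And>j i. j \<in> J \<Longrightarrow> i \<in> I j \<Longrightarrow> g j i \<in> G"
  shows "\<exists>G'. monotone_circuit (N + card J * c) G' \<and> G \<subseteq> G' \<and>
    (\<forall>j\<in>J. (\<lambda>S. h j S \<and> (\<forall>i\<in>I j. g j i S)) \<in> G')"
  using assms(1,3-)
proof (induction J)
  case empty
  then show ?case using assms(2) by auto
next
  case (insert j J)
  then obtain G' where G': "monotone_circuit (N + card J * c) G'" "G \<subseteq> G'"
    "\<forall>j\<in>J. (\<lambda>S. h j S \<and> (\<forall>i\<in>I j. g j i S)) \<in> G'" by auto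
  have "h j \<in> G'" "\<And>i. i \<in> I j \<Longrightarrow> g j i \<in> G'" "finite (I j)" using insert.prems G'(2) by auto
  then obtain G'' where G'': "monotone_circuit (N + card J * c + card (I j)) G''" "G' \<subseteq> G''"
    "(\<lambda>S. h j S \<and> (\<forall>i\<in>I j. g j i S)) \<in> G''"
    using monotone_circuit_Ball[OF _ G'(1), of "I j" "h j" "g j"] by blast
  have "N + card J * c + card (I j) \<le> N + card (insert j J) * c"
    using insert.prems(1)[of j] insert.hyps by simp
  from monotone_circuit_mono[OF G''(1) this] show ?case using G' G'' by (intro exI[of _ G'']) auto
qed

section \<open>The approximation method\<close>

text \<open>Witnesses have at most \<open>k\<close> edges and sunflowers \<open>p\<close> petals. A closed family has at
  most \<open>M\<^bsup>3r\<^esup>\<close> minimal members with \<open>r\<close> edges, and each conjunction loses at most a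
  fraction \<open>L\<^bsup>-k\<^esup>\<close> of the permutations.\<close>

locale matching_approximation =
  fixes V :: "'a set" and k p M L :: nat
  assumes finite_V: "finite V" and k_pos: "0 < k" and p_ge: "2 \<le> p"
    and M_ge: "3 * (2 * k) * (p + (2 * k)\<^sup>2) \<le> M" and L_ge: "k \<le> L"
    and card_V_ge: "M ^ 3 * L \<le> card V - 2 * k"
begin

definition perms :: "('a \<Rightarrow> 'a) set" where
  "perms = {\<pi>. \<pi> permutes V}"

definition odd_colourings :: "('a + 'a) set set" where
  "odd_colourings = {X \<in> Pow (V <+> V). odd (card X)}"

definition forces :: "('a + 'a) set set \<Rightarrow> ('a \<times> 'a) set \<Rightarrow> (('a \<times> 'a) set \<Rightarrow> bool) \<Rightarrow> bool" where
  "forces D T g \<longleftrightarrow> (\<forall>X\<in>odd_colourings - D. T \<subseteq> monochrom X \<longrightarrow> g (monochrom X))"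

text \<open>\<open>D\<close> and \<open>E\<close> are the colourings and permutations on which the approximation may fail.\<close>

definition approximable ::
    "('a + 'a) set set \<Rightarrow> ('a \<Rightarrow> 'a) set \<Rightarrow> (('a \<times> 'a) set \<Rightarrow> bool) \<Rightarrow> bool" where
  "approximable D E g \<longleftrightarrow>
     (\<forall>\<pi>\<in>perms - E. g (perm_graph V \<pi>) \<longrightarrow> (\<exists>T\<subseteq>perm_graph V \<pi>. card T \<le> k \<and> forces D T g))"

text \<open>This many colourings may avoid \<open>p\<close> independent petals of at most \<open>2k\<close> edges each.\<close>

definition cover_tolerance :: real where
  "cover_tolerance = (1 - 1 / 2 ^ (2 * (2 * k))) ^ p * 2 ^ (2 * card V)"

definition cover_error :: real where
  "cover_error = cover_tolerance * card (matchings V (2 * k))"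

definition few_errors :: "nat \<Rightarrow> ('a + 'a) set set \<Rightarrow> ('a \<Rightarrow> 'a) set \<Rightarrow> bool" where
  "few_errors N D E \<longleftrightarrow> finite D \<and> E \<subseteq> perms \<and>
     real (card D) \<le> N * cover_error \<and> card E * L ^ k \<le> N * fact (card V)"

definition closed_family :: "('a \<times> 'a) set set \<Rightarrow> bool" where
  "closed_family \<C> \<longleftrightarrow> \<C> \<subseteq> matchings V (2 * k) \<and>
     cover_closed (matchings V (2 * k)) (colourings (V <+> V)) cover_tolerance \<C>"

definition spurious :: "('a \<times> 'a) set set \<Rightarrow> ('a \<times> 'a) set set \<Rightarrow> ('a + 'a) set set" where
  "spurious \<T> \<C> = \<Union>(colourings (V <+> V) ` \<C>) - \<Union>(colourings (V <+> V) ` \<T>)"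

definition heavy_perms :: "('a \<times> 'a) set set \<Rightarrow> ('a \<Rightarrow> 'a) set" where
  "heavy_perms \<C> = {\<pi> \<in> perms. \<exists>T\<in>minimal_members \<C>. T \<subseteq> perm_graph V \<pi> \<and> k < card T}"

lemma finite_perms: "finite perms"
  unfolding perms_def using finite_V by (rule finite_permutations)

lemma card_perms: "card perms = fact (card V)"
  unfolding perms_def using finite_V by (simp add: card_permutations)

lemma L_pos: "0 < L" and M_pos: "0 < M"
  using k_pos L_ge p_ge M_ge by (auto intro: Nat.gr0I)

lemma card_V_gt: "2 * k < card V"
proof -
  have "0 < M ^ 3 * L" using L_pos M_pos by simp
  then show ?thesis using card_V_ge by linarith
qed

lemma cover_tolerance_nonneg: "0 \<le> cover_tolerance"
  unfolding cover_tolerance_def by simp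

lemma approximable_mono:
  assumes "approximable D E g" "D \<subseteq> D'" "E \<subseteq> E'"
  shows "approximable D' E' g"
  unfolding approximable_def
proof (intro ballI impI)
  fix \<pi> assume "\<pi> \<in> perms - E'" "g (perm_graph V \<pi>)"
  then obtain T where T: "T \<subseteq> perm_graph V \<pi>" "card T \<le> k" "forces D T g"
    using assms(1,3) unfolding approximable_def by blast
  then have "forces D' T g" using assms(2) by (auto simp: forces_def)
  with T(1,2) show "\<exists>T\<subseteq>perm_graph V \<pi>. card T \<le> k \<and> forces D' T g" by blast
qed

lemma approximable_input_gates:
  assumes "g \<in> input_gates" shows "approximable D E g"
proof -
  consider (true) "g = (\<lambda>S. True)" | (edge) e where "g = (\<lambda>S. e \<in> S)"
    using assms by (auto simp: input_gates_def)
  then show ?thesis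
  proof cases
    case true
    then show ?thesis unfolding approximable_def forces_def by (intro ballI impI exI[of _ "{}"]) simp
  next
    case edge
    then show ?thesis
      unfolding approximable_def forces_def using k_pos by (intro ballI impI exI[of _ "{e}"]) simp
  qed
qed

lemma approximable_disjunctions:
  assumes "\<forall>g\<in>G. approximable D E g" "h \<in> disjunctions G"
  shows "approximable D E h"
  unfolding approximable_def
proof (intro ballI impI)
  fix \<pi> assume \<pi>: "\<pi> \<in> perms - E" "h (perm_graph V \<pi>)"
  obtain Z where Z: "Z \<subseteq> G" "h = (\<lambda>S. \<exists>g\<in>Z. g S)" using assms(2) by (auto simp: disjunctions_def)
  then obtain g where g: "g \<in> Z" "g (perm_graph V \<pi>)" using \<pi>(2) by blast
  then have "approximable D E g" using assms(1) Z(1) by blast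
  then obtain T where T: "T \<subseteq> perm_graph V \<pi>" "card T \<le> k" "forces D T g"
    using \<pi>(1) g(2) unfolding approximable_def by blast
  then have "forces D T h" using g(1) Z(2) unfolding forces_def by blast
  with T(1,2) show "\<exists>T\<subseteq>perm_graph V \<pi>. card T \<le> k \<and> forces D T h" by blast
qed

lemma card_perms_above_minimal_le:
  assumes "closed_family \<C>" "r \<le> 2 * k"
  shows "card {\<pi> \<in> perms. \<exists>T\<in>minimal_members \<C>. T \<subseteq> perm_graph V \<pi> \<and> card T = r} * L ^ r \<le> fact (card V)"
    (is "card ?A * _ \<le> _")
proof -
  let ?min = "{T \<in> minimal_members \<C>. card T = r}"
  let ?above = "\<lambda>T. {\<pi>. \<pi> permutes V \<and> T \<subseteq> perm_graph V \<pi>}"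
  have \<C>: "\<C> \<subseteq> matchings V (2 * k)"
    "cover_closed (matchings V (2 * k)) (colourings (V <+> V)) cover_tolerance \<C>"
    using assms(1) by (simp_all add: closed_family_def)
  have min: "?min \<subseteq> matchings V (2 * k)" using \<C>(1) by (auto simp: minimal_members_def)
  then have fin: "finite ?min" using finite_matchings[OF finite_V] by (rule finite_subset)
  have "?A = (\<Union>T\<in>?min. ?above T)" by (auto simp: perms_def)
  then have union: "card ?A \<le> (\<Sum>T\<in>?min. card (?above T))" using card_UN_le[OF fin] by simp
  have "card ?A * (M ^ 3 * L) ^ r \<le> (\<Sum>T\<in>?min. card (?above T)) * (card V - 2 * k) ^ r"
    using card_V_ge by (intro mult_le_mono union power_mono) simp_all
  also have "\<dots> = (\<Sum>T\<in>?min. card (?above T) * (card V - 2 * k) ^ card T)"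
    by (simp add: sum_distrib_right)
  also have "\<dots> \<le> (\<Sum>T\<in>?min. fact (card V))"
    using min card_V_gt by (intro sum_mono card_perms_containing_mult_le finite_V) auto
  also have "\<dots> = card ?min * fact (card V)" by simp
  also have "\<dots> \<le> M ^ (3 * r) * fact (card V)"
    using card_minimal_members_le[OF finite_V \<C>(1) _ p_ge M_ge assms(2)] \<C>(2)
    by (intro mult_le_mono1) (simp add: cover_tolerance_def)
  also have "(M ^ 3 * L) ^ r = M ^ (3 * r) * L ^ r" by (simp only: power_mult_distrib power_mult)
  finally have "M ^ (3 * r) * (card ?A * L ^ r) \<le> M ^ (3 * r) * fact (card V)"
    by (simp only: mult.left_commute)
  then show ?thesis using M_pos by simp
qed

lemma card_heavy_perms_le:
  assumes "closed_family \<C>"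
  shows "card (heavy_perms \<C>) * L ^ k \<le> fact (card V)"
proof -
  let ?A = "\<lambda>r. {\<pi> \<in> perms. \<exists>T\<in>minimal_members \<C>. T \<subseteq> perm_graph V \<pi> \<and> card T = r}"
  have level: "card (?A r) * L ^ (k + 1) \<le> fact (card V)" if "r \<in> {k<..2 * k}" for r
  proof -
    have "card (?A r) * L ^ (k + 1) \<le> card (?A r) * L ^ r"
      using that L_pos by (intro mult_le_mono2 power_increasing) auto
    also have "\<dots> \<le> fact (card V)" using that by (intro card_perms_above_minimal_le[OF assms]) auto
    finally show ?thesis .
  qed
  have "heavy_perms \<C> \<subseteq> (\<Union>r\<in>{k<..2 * k}. ?A r)"
  proof
    fix \<pi> assume "\<pi> \<in> heavy_perms \<C>"
    then obtain T where T: "\<pi> \<in> perms" "T \<in> minimal_members \<C>" "T \<subseteq> perm_graph V \<pi>" "k < card T"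
      by (auto simp: heavy_perms_def)
    then have "card T \<in> {k<..2 * k}"
      using assms by (auto simp: closed_family_def minimal_members_def matchings_def)
    then show "\<pi> \<in> (\<Union>r\<in>{k<..2 * k}. ?A r)" using T by (intro UN_I[of "card T"]) auto
  qed
  then have "card (heavy_perms \<C>) \<le> card (\<Union>r\<in>{k<..2 * k}. ?A r)"
    by (rule card_mono[rotated]) (simp add: finite_perms)
  also have "\<dots> \<le> (\<Sum>r\<in>{k<..2 * k}. card (?A r))" by (intro card_UN_le) simp
  finally have "card (heavy_perms \<C>) * L ^ (k + 1) \<le> (\<Sum>r\<in>{k<..2 * k}. card (?A r)) * L ^ (k + 1)"
    by (rule mult_le_mono1)
  also have "\<dots> = (\<Sum>r\<in>{k<..2 * k}. card (?A r) * L ^ (k + 1))" by (rule sum_distrib_right)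
  also have "\<dots> \<le> (\<Sum>r\<in>{k<..2 * k}. fact (card V))" by (rule sum_mono) (rule level)
  also have "\<dots> = k * fact (card V)" by simp
  also have "\<dots> \<le> L * fact (card V)" using L_ge by (rule mult_le_mono1)
  finally show ?thesis using L_pos by (simp add: mult.left_commute)
qed

definition joint_witnesses ::
    "('a + 'a) set set \<Rightarrow> (('a \<times> 'a) set \<Rightarrow> bool) \<Rightarrow> (('a \<times> 'a) set \<Rightarrow> bool) \<Rightarrow> ('a \<times> 'a) set set" where
  "joint_witnesses D g h = {T \<in> matchings V (2 * k). forces D T g \<and> forces D T h}"

lemma joint_witness_Un:
  assumes "\<pi> \<in> perms" "T\<^sub>1 \<subseteq> perm_graph V \<pi>" "T\<^sub>2 \<subseteq> perm_graph V \<pi>" "card T\<^sub>1 \<le> k" "card T\<^sub>2 \<le> k"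
    and "forces D T\<^sub>1 g" "forces D T\<^sub>2 h"
  shows "T\<^sub>1 \<union> T\<^sub>2 \<in> joint_witnesses D g h"
proof -
  have "matching (T\<^sub>1 \<union> T\<^sub>2)" "T\<^sub>1 \<union> T\<^sub>2 \<subseteq> V \<times> V"
    using assms(1-3) matching_subset[OF matching_perm_graph[OF finite_V]] perm_graph_subset[of \<pi> V]
    by (auto simp: perms_def)
  moreover have "card (T\<^sub>1 \<union> T\<^sub>2) \<le> 2 * k" using card_Un_le[of T\<^sub>1 T\<^sub>2] assms(4,5) by linarith
  ultimately show ?thesis using assms(6,7) by (auto simp: joint_witnesses_def matchings_def forces_def)
qed

lemma approximable_conj_closed:
  assumes "approximable D E g" "approximable D E h"
    and "joint_witnesses D g h \<subseteq> \<C>" "closed_family \<C>"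
  shows "approximable (D \<union> spurious (joint_witnesses D g h) \<C>) (E \<union> heavy_perms \<C>) (\<lambda>S. g S \<and> h S)"
    (is "approximable (D \<union> ?D') _ _")
  unfolding approximable_def
proof (intro ballI impI, elim conjE)
  fix \<pi> assume \<pi>: "\<pi> \<in> perms - (E \<union> heavy_perms \<C>)" "g (perm_graph V \<pi>)" "h (perm_graph V \<pi>)"
  obtain T\<^sub>1 where T\<^sub>1: "T\<^sub>1 \<subseteq> perm_graph V \<pi>" "card T\<^sub>1 \<le> k" "forces D T\<^sub>1 g"
    using assms(1) \<pi>(1,2) unfolding approximable_def by blast
  obtain T\<^sub>2 where T\<^sub>2: "T\<^sub>2 \<subseteq> perm_graph V \<pi>" "card T\<^sub>2 \<le> k" "forces D T\<^sub>2 h"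
    using assms(2) \<pi>(1,3) unfolding approximable_def by blast
  have "T\<^sub>1 \<union> T\<^sub>2 \<in> \<C>" using joint_witness_Un[of \<pi> T\<^sub>1 T\<^sub>2] T\<^sub>1 T\<^sub>2 \<pi>(1) assms(3) by blast
  moreover have "finite \<C>"
    using assms(4) finite_matchings[OF finite_V] finite_subset unfolding closed_family_def by blast
  ultimately obtain T where T: "T \<in> minimal_members \<C>" "T \<subseteq> T\<^sub>1 \<union> T\<^sub>2" by (elim minimal_member_below)
  have sub: "T \<subseteq> perm_graph V \<pi>" using T(2) T\<^sub>1(1) T\<^sub>2(1) by blast
  have "card T \<le> k"
  proof (rule ccontr)
    assume "\<not> card T \<le> k"
    then have "\<pi> \<in> heavy_perms \<C>" using \<pi>(1) T(1) sub by (auto simp: heavy_perms_def not_le)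
    then show False using \<pi>(1) by blast
  qed
  moreover have "forces (D \<union> ?D') T (\<lambda>S. g S \<and> h S)"
    unfolding forces_def
  proof (intro ballI impI)
    fix X assume X: "X \<in> odd_colourings - (D \<union> ?D')" "T \<subseteq> monochrom X"
    then have "X \<in> \<Union>(colourings (V <+> V) ` \<C>)"
      using T(1) by (auto simp: colourings_def odd_colourings_def minimal_members_def)
    then obtain T' where "T' \<in> joint_witnesses D g h" "T' \<subseteq> monochrom X"
      using X(1) by (auto simp: spurious_def colourings_def)
    then show "g (monochrom X) \<and> h (monochrom X)"
      using X(1) by (auto simp: joint_witnesses_def forces_def)
  qed
  ultimately show "\<exists>T\<subseteq>perm_graph V \<pi>. card T \<le> k \<and> forces (D \<union> ?D') T (\<lambda>S. g S \<and> h S)"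
    using sub by blast
qed

lemma approximable_conj:
  assumes "few_errors N D E" "approximable D E g" "approximable D E h"
  obtains D' E' where "few_errors (Suc N) D' E'" "D \<subseteq> D'" "E \<subseteq> E'"
    "approximable D' E' (\<lambda>S. g S \<and> h S)"
proof -
  have "joint_witnesses D g h \<subseteq> matchings V (2 * k)" by (auto simp: joint_witnesses_def)
  then obtain \<C> where \<C>: "joint_witnesses D g h \<subseteq> \<C>" "closed_family \<C>"
    "real (card (spurious (joint_witnesses D g h) \<C>)) \<le> cover_error"
    using cover_closure[OF finite_matchings[OF finite_V] _ cover_tolerance_nonneg]
    unfolding closed_family_def spurious_def cover_error_def by metis
  let ?D' = "spurious (joint_witnesses D g h) \<C>"
  have "?D' \<subseteq> Pow (V <+> V)" by (auto simp: spurious_def colourings_def)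
  then have fin: "finite ?D'" by (rule finite_subset) (simp add: finite_V)
  have "real (card (D \<union> ?D')) \<le> real (card D) + real (card ?D')"
    using card_Un_le[of D ?D'] by linarith
  also have "\<dots> \<le> N * cover_error + cover_error"
    using assms(1) \<C>(3) by (intro add_mono) (simp_all add: few_errors_def)
  finally have D': "real (card (D \<union> ?D')) \<le> Suc N * cover_error" by (simp add: algebra_simps)
  have "card (E \<union> heavy_perms \<C>) * L ^ k \<le> (card E + card (heavy_perms \<C>)) * L ^ k"
    by (intro mult_le_mono1 card_Un_le)
  also have "\<dots> \<le> N * fact (card V) + fact (card V)"
    unfolding add_mult_distrib using assms(1) card_heavy_perms_le[OF \<C>(2)]
    by (intro add_mono) (simp_all add: few_errors_def)
  finally have "few_errors (Suc N) (D \<union> ?D') (E \<union> heavy_perms \<C>)"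
    using assms(1) fin D' by (auto simp: few_errors_def heavy_perms_def)
  then show ?thesis using that approximable_conj_closed[OF assms(2,3) \<C>(1,2)] by blast
qed

lemma monotone_circuit_approximable:
  "monotone_circuit N G \<Longrightarrow> \<exists>D E. few_errors N D E \<and> (\<forall>g\<in>G. approximable D E g)"
proof (induction rule: monotone_circuit.induct)
  case inputs
  have "few_errors 0 {} {}" by (simp add: few_errors_def)
  then show ?case using approximable_input_gates by blast
next
  case (disj N G)
  then show ?case using approximable_disjunctions by blast
next
  case (conj N G g h)
  then obtain D E where DE: "few_errors N D E" "\<forall>g\<in>G. approximable D E g" by blast
  have "approximable D E g" "approximable D E h" using DE(2) conj.hyps(2,3) by blast+
  then obtain D' E' where D'E': "few_errors (Suc N) D' E'" "D \<subseteq> D'" "E \<subseteq> E'"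
    "approximable D' E' (\<lambda>S. g S \<and> h S)"
    by (rule approximable_conj[OF DE(1)])
  then have "\<forall>g\<in>insert (\<lambda>S. g S \<and> h S) G. approximable D' E' g"
    using DE(2) approximable_mono by auto
  with D'E'(1) show ?case by blast
qed

lemma forced_errors_ge:
  assumes "finite D" "matching T" "ends T \<subseteq> V <+> V" "card T \<le> k" "forces D T g"
    and reject: "\<And>X. X \<subseteq> V <+> V \<Longrightarrow> odd (card X) \<Longrightarrow> \<not> g (monochrom X)"
  shows "2 ^ (2 * card V) \<le> 2 ^ (2 * k + 1) * card D"
proof -
  let ?odd = "{X \<in> colourings (V <+> V) T. odd (card X)}"
  have card_V_Plus: "card (V <+> V) = 2 * card V" using finite_V by (simp add: card_Plus)
  then have "ends T \<noteq> V <+> V" using card_ends[OF assms(2)] assms(4) card_V_gt by fastforce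
  then have "2 ^ (2 * card V) \<le> 2 ^ (2 * card T + 1) * card ?odd"
    using card_odd_colourings_ge[of "V <+> V" T] finite_V assms(2,3) card_V_Plus by auto
  also have "\<dots> \<le> 2 ^ (2 * k + 1) * card D"
  proof (intro mult_le_mono power_increasing card_mono assms(1))
    show "?odd \<subseteq> D" using assms(5) reject by (auto simp: forces_def odd_colourings_def colourings_def)
  qed (use assms(4) in auto)
  finally show ?thesis .
qed

theorem separating_circuit_bound:
  assumes "monotone_circuit N G" "g \<in> G"
    and accept: "\<And>\<pi>. \<pi> permutes V \<Longrightarrow> g (perm_graph V \<pi>)"
    and reject: "\<And>X. X \<subseteq> V <+> V \<Longrightarrow> odd (card X) \<Longrightarrow> \<not> g (monochrom X)"
  shows "L ^ k \<le> N \<or> 2 ^ (2 * card V) \<le> N * cover_error * 2 ^ (2 * k + 1)"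
proof -
  obtain D E where few: "few_errors N D E" and approx: "approximable D E g"
    using monotone_circuit_approximable assms(1,2) by blast
  show ?thesis
  proof (cases "perms \<subseteq> E")
    case True
    moreover have "E \<subseteq> perms" using few by (simp add: few_errors_def)
    ultimately have "fact (card V) * L ^ k = card E * L ^ k" using card_perms by auto
    also have "\<dots> \<le> N * fact (card V)" using few by (simp add: few_errors_def)
    finally show ?thesis by simp
  next
    case False
    then obtain \<pi> where \<pi>: "\<pi> \<in> perms - E" by blast
    then have permutes: "\<pi> permutes V" by (simp add: perms_def)
    then obtain T where T: "T \<subseteq> perm_graph V \<pi>" "card T \<le> k" "forces D T g"
      using \<pi> accept approx unfolding approximable_def by blast
    have "matching T" by (rule matching_subset[OF matching_perm_graph[OF finite_V permutes] T(1)])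
    moreover have "ends T \<subseteq> V <+> V"
      using perm_graph_subset[OF permutes] T(1) by (auto simp: ends_def)
    ultimately have "2 ^ (2 * card V) \<le> 2 ^ (2 * k + 1) * card D"
      using few T(2,3) reject by (intro forced_errors_ge) (auto simp: few_errors_def)
    then have "real (2 ^ (2 * card V)) \<le> real (2 ^ (2 * k + 1) * card D)" by (rule of_nat_mono)
    also have "\<dots> = real (card D) * 2 ^ (2 * k + 1)" by simp
    also have "\<dots> \<le> N * cover_error * 2 ^ (2 * k + 1)"
      using few unfolding few_errors_def by (intro mult_right_mono) auto
    finally show ?thesis by simp
  qed
qed

end

section \<open>The lower bound for odd factors\<close>

definition odd_factor :: "'a set \<Rightarrow> ('a \<times> 'a) set \<Rightarrow> bool" where
  "odd_factor V R \<longleftrightarrow> R \<subseteq> V \<times> V \<and>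
     (\<forall>i\<in>V. odd (card {j. (i, j) \<in> R})) \<and> (\<forall>j\<in>V. odd (card {i. (i, j) \<in> R}))"

definition has_odd_factor :: "'a set \<Rightarrow> ('a \<times> 'a) set \<Rightarrow> bool" where
  "has_odd_factor V S \<longleftrightarrow> (\<exists>R\<subseteq>S. odd_factor V R)"

lemma odd_factor_perm_graph:
  assumes "\<pi> permutes V" shows "odd_factor V (perm_graph V \<pi>)"
proof -
  have "{j. (i, j) \<in> perm_graph V \<pi>} = {\<pi> i}" if "i \<in> V" for i
    using that by (auto simp: mem_perm_graph)
  moreover have "{i. (i, j) \<in> perm_graph V \<pi>} = {inv \<pi> j}" if "j \<in> V" for j
    using that permutes_inverses[OF assms] permutes_in_image[OF permutes_inv[OF assms]]
    by (auto simp: mem_perm_graph)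
  ultimately show ?thesis using perm_graph_subset[OF assms] by (simp add: odd_factor_def)
qed

lemma even_card_edges_iff:
  assumes "finite A" "\<And>i. i \<in> A \<Longrightarrow> finite {j. (i, j) \<in> R} \<and> odd (card {j. (i, j) \<in> R})"
  shows "even (card {(i, j) \<in> R. i \<in> A}) \<longleftrightarrow> even (card A)"
proof -
  have "{(i, j) \<in> R. i \<in> A} = (SIGMA i:A. {j. (i, j) \<in> R})" by auto
  then have "card {(i, j) \<in> R. i \<in> A} = (\<Sum>i\<in>A. card {j. (i, j) \<in> R})"
    using assms by (simp add: card_SigmaI)
  moreover have "{i \<in> A. odd (card {j. (i, j) \<in> R})} = A" using assms(2) by blast
  ultimately show ?thesis by (simp add: even_sum_iff[OF assms(1)])
qed

text \<open>In a monochromatic graph the edges with left end in \<open>X\<close> are those with right end in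
  \<open>X\<close>; in an odd factor their numbers have the parities of the two parts of \<open>X\<close>.\<close>

lemma not_has_odd_factor_monochrom:
  assumes "finite V" "X \<subseteq> V <+> V" "odd (card X)"
  shows "\<not> has_odd_factor V (monochrom X)"
proof
  assume "has_odd_factor V (monochrom X)"
  then obtain R where R: "R \<subseteq> monochrom X" "R \<subseteq> V \<times> V" "\<And>i. i \<in> V \<Longrightarrow> odd (card {j. (i, j) \<in> R})"
    "\<And>j. j \<in> V \<Longrightarrow> odd (card {i. (i, j) \<in> R})" unfolding has_odd_factor_def odd_factor_def by blast
  have fin: "finite {j. (i, j) \<in> R}" "finite {i. (i, j) \<in> R}" for i j
    by (rule finite_subset[OF _ assms(1)]; use R(2) in blast)+
  let ?A = "{i \<in> V. Inl i \<in> X}" and ?B = "{j \<in> V. Inr j \<in> X}"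
  have "even (card ?A) \<longleftrightarrow> even (card {(i, j) \<in> R. i \<in> ?A})"
    using assms(1) R(3) fin by (intro even_card_edges_iff[symmetric]) auto
  also have "card {(i, j) \<in> R. i \<in> ?A} = card {(j, i) \<in> R\<inverse>. j \<in> ?B}"
  proof -
    have "{(j, i) \<in> R\<inverse>. j \<in> ?B} = prod.swap ` {(i, j) \<in> R. i \<in> ?A}"
      using R(1,2) by (force simp: monochrom_def)
    then show ?thesis by (simp add: card_image)
  qed
  also have "even \<dots> \<longleftrightarrow> even (card ?B)"
    using assms(1) R(4) fin by (intro even_card_edges_iff) auto
  finally have "even (card ?A + card ?B)" by simp
  moreover have "X = ?A <+> ?B" using assms(2) by (auto simp: Plus_def)
  ultimately show False using assms(1,3) card_Plus[of ?A ?B] by simp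
qed

lemma cube_le_two_power: "20 \<le> k \<Longrightarrow> 30 * k ^ 3 \<le> (2::nat) ^ k"
proof (induction k rule: nat_induct_at_least)
  case (Suc k)
  have "20 * k\<^sup>2 \<le> k * k\<^sup>2" "20 * k \<le> k * k" using Suc.hyps by (simp_all only: mult_le_mono1)
  then have "3 * k\<^sup>2 + 3 * k + 1 \<le> k ^ 3"
    using Suc.hyps by (simp only: power2_eq_square power3_eq_cube mult.assoc)
  then have "(Suc k) ^ 3 \<le> 2 * k ^ 3" by (simp add: power2_eq_square power3_eq_cube algebra_simps)
  then show ?case using Suc.IH by simp
qed simp

lemma one_minus_inverse_power_le_half:
  assumes "0 < W" shows "(1 - 1 / real W) ^ W \<le> 1 / 2"
proof -
  have "(1 - 1 / real W) ^ W \<le> exp (- 1)"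
    using exp_ge_one_minus_x_over_n_power_n[of 1 W] assms by simp
  also have "\<dots> \<le> 1 / 2" using exp_ge_add_one_self[of 1] by (simp add: exp_minus field_simps)
  finally show ?thesis .
qed

text \<open>With \<open>2\<^bsup>20k\<^esup>\<close> vertices, sunflowers with \<open>2\<^bsup>5k\<^esup>\<close> petals already occur in
  families of \<open>2\<^bsup>18kr\<^esup>\<close> matchings with \<open>r\<close> edges, while a random permutation contains
  such a matching with probability about \<open>2\<^bsup>-20kr\<^esup>\<close>.\<close>

lemma matching_approximation_two_powers:
  assumes "20 \<le> k" "card V = 2 ^ (20 * k)"
  shows "matching_approximation V k (2 ^ (5 * k)) (2 ^ (6 * k)) (2 ^ k)"
proof
  show "finite V" using assms(2) card.infinite by fastforce
  show "0 < k" using assms(1) by simp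
  show "(2::nat) \<le> 2 ^ (5 * k)" using assms(1) self_le_power[of "2::nat" "5 * k"] by simp
  show "k \<le> 2 ^ k" using less_exp[of k] by simp
  show "3 * (2 * k) * (2 ^ (5 * k) + (2 * k)\<^sup>2) \<le> 2 ^ (6 * k)"
  proof -
    have "2 ^ (5 * k) + (2 * k)\<^sup>2 \<le> 2 ^ (5 * k) * k\<^sup>2 + 2 ^ (5 * k) * (4 * k\<^sup>2)"
      using assms(1) by (intro add_mono) (simp_all add: power_mult_distrib)
    also have "\<dots> = 5 * 2 ^ (5 * k) * k\<^sup>2" by simp
    finally have "2 ^ (5 * k) + (2 * k)\<^sup>2 \<le> 5 * 2 ^ (5 * k) * k\<^sup>2" .
    then have "3 * (2 * k) * (2 ^ (5 * k) + (2 * k)\<^sup>2) \<le> 3 * (2 * k) * (5 * 2 ^ (5 * k) * k\<^sup>2)"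
      by (rule mult_le_mono2)
    also have "\<dots> = 30 * k ^ 3 * 2 ^ (5 * k)" by (simp add: power2_eq_square power3_eq_cube)
    also have "\<dots> \<le> 2 ^ k * 2 ^ (5 * k)" using cube_le_two_power[OF assms(1)] by (rule mult_le_mono1)
    also have "\<dots> = 2 ^ (6 * k)" by (simp flip: power_add)
    finally show ?thesis .
  qed
  show "(2 ^ (6 * k)) ^ 3 * 2 ^ k \<le> card V - 2 * k"
  proof -
    have "2 * k \<le> 2 ^ Suc k" using less_exp[of k] by simp
    also have "\<dots> \<le> 2 ^ (19 * k)" using assms(1) by (intro power_increasing) auto
    finally have "2 * k + 2 ^ (19 * k) \<le> 2 ^ Suc (19 * k)" by simp
    also have "\<dots> \<le> card V" unfolding assms(2) using assms(1) by (intro power_increasing) auto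
    finally have "2 ^ (19 * k) \<le> card V - 2 * k" by simp
    moreover have "(2 ^ (6 * k)) ^ 3 * 2 ^ k = (2::nat) ^ (19 * k)" by (simp flip: power_mult power_add)
    ultimately show ?thesis by simp
  qed
qed

lemma card_matchings_le_two_power:
  assumes "finite V" "card V = 2 ^ (20 * k)"
  shows "real (card (matchings V (2 * k))) \<le> 2 ^ ((40 * k + 1) * (2 * k))"
proof -
  have "(card V)\<^sup>2 + 1 \<le> 2 ^ (40 * k + 1)" unfolding assms(2) by (simp flip: power_mult)
  then have "((card V)\<^sup>2 + 1) ^ (2 * k) \<le> (2 ^ (40 * k + 1)) ^ (2 * k)" by (rule power_mono) simp
  with card_matchings_le[OF assms(1)] have "card (matchings V (2 * k)) \<le> (2 ^ (40 * k + 1)) ^ (2 * k)"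
    by (rule order_trans)
  then have "real (card (matchings V (2 * k))) \<le> real ((2 ^ (40 * k + 1)) ^ (2 * k))"
    by (rule of_nat_mono)
  then show ?thesis by (simp only: of_nat_power of_nat_numeral power_mult)
qed

lemma avoiding_probability_le:
  "(1 - 1 / 2 ^ (4 * k)) ^ (2 ^ (5 * k)) \<le> (1 / 2 ^ (2 ^ k) :: real)"
proof -
  have "(2::nat) ^ (5 * k) = 2 ^ (4 * k) * 2 ^ k" by (simp flip: power_add)
  then have "(1 - 1 / 2 ^ (4 * k)) ^ (2 ^ (5 * k))
      = ((1 - 1 / real (2 ^ (4 * k))) ^ (2 ^ (4 * k))) ^ (2 ^ k)"
    by (simp add: power_mult)
  also have "\<dots> \<le> (1 / 2) ^ (2 ^ k)"
    by (intro power_mono one_minus_inverse_power_le_half) auto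
  finally show ?thesis by (simp add: power_one_over)
qed

lemma few_spurious_colourings:
  assumes "20 \<le> k" "finite V" "card V = 2 ^ (20 * k)" "N \<le> 2 ^ (k * k)"
  shows "real N * ((1 - 1 / 2 ^ (4 * k)) ^ (2 ^ (5 * k)) * 2 ^ (2 * card V) * card (matchings V (2 * k)))
    * 2 ^ (2 * k + 1) < 2 ^ (2 * card V)"
    (is "real N * (?avoiding * _ * _) * _ < _")
proof -
  define m where "m = (40 * k + 1) * (2 * k)"
  have avoiding: "0 \<le> ?avoiding" "?avoiding \<le> 1 / 2 ^ (2 ^ k)" using avoiding_probability_le by auto
  have N: "real N \<le> 2 ^ (k * k)" using of_nat_mono[OF assms(4), where 'a = real] by simp
  have "real N * (?avoiding * 2 ^ (2 * card V) * card (matchings V (2 * k))) * 2 ^ (2 * k + 1)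
      \<le> 2 ^ (k * k) * (1 / 2 ^ (2 ^ k) * 2 ^ (2 * card V) * 2 ^ m) * 2 ^ (2 * k + 1)"
    using avoiding N card_matchings_le_two_power[OF assms(2,3), folded m_def]
    by (intro mult_right_mono mult_mono) simp_all
  also have "\<dots> = 2 ^ (k * k + m + (2 * k + 1)) / 2 ^ (2 ^ k) * 2 ^ (2 * card V)"
    by (simp add: power_add)
  also have "\<dots> < 1 * 2 ^ (2 * card V)"
  proof (rule mult_strict_right_mono)
    have "20 * k \<le> k * k" "20 * (k * k) \<le> k * (k * k)" using assms(1) by (auto intro: mult_le_mono1)
    moreover have "30 * (k * (k * k)) \<le> 2 ^ k"
      using cube_le_two_power[OF assms(1)] by (simp add: power3_eq_cube)
    moreover have "m = 80 * (k * k) + 2 * k" by (simp add: m_def algebra_simps)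
    ultimately have "k * k + m + (2 * k + 1) < 2 ^ k" using assms(1) by linarith
    then have "(2::real) ^ (k * k + m + (2 * k + 1)) < 2 ^ (2 ^ k)"
      by (rule power_strict_increasing) simp
    then show "2 ^ (k * k + m + (2 * k + 1)) / 2 ^ (2 ^ k) < (1::real)" by (simp add: divide_less_eq)
  qed simp
  finally show ?thesis by simp
qed

theorem odd_factor_circuit_lower_bound:
  assumes "20 \<le> k" "card V = 2 ^ (20 * k)" "monotone_circuit N G" "has_odd_factor V \<in> G"
  shows "2 ^ (k * k) \<le> N"
proof (rule ccontr)
  interpret matching_approximation V k "2 ^ (5 * k)" "2 ^ (6 * k)" "2 ^ k"
    using assms(1,2) by (rule matching_approximation_two_powers)
  assume "\<not> 2 ^ (k * k) \<le> N"
  then have small: "N < 2 ^ (k * k)" by simp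
  then have "N * cover_error * 2 ^ (2 * k + 1) < 2 ^ (2 * card V)"
    using few_spurious_colourings[OF assms(1) finite_V assms(2)]
    unfolding cover_error_def cover_tolerance_def by simp
  moreover have "(2 ^ k) ^ k \<le> N \<or> 2 ^ (2 * card V) \<le> N * cover_error * 2 ^ (2 * k + 1)"
  proof (rule separating_circuit_bound[OF assms(3,4)])
    show "has_odd_factor V (perm_graph V \<pi>)" if "\<pi> permutes V" for \<pi>
      using odd_factor_perm_graph[OF that] unfolding has_odd_factor_def by blast
  qed (rule not_has_odd_factor_monochrom[OF finite_V])
  ultimately show False using small by (simp add: power_mult)
qed

section \<open>Models of clause-sets\<close>

definition models :: "'v passign \<Rightarrow> 'v cls set \<Rightarrow> bool" where
  "models \<psi> F \<longleftrightarrow> (\<forall>C\<in>F. \<exists>x\<in>C. lit_val \<psi> x = Some 1)"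

definition true_lits :: "'v passign \<Rightarrow> 'v lit set" where
  "true_lits \<phi> = {x. lit_val \<phi> x = Some 1}"

definition lits :: "'v cls set \<Rightarrow> 'v lit set" where
  "lits F = Pos ` vars F \<union> Neg ` vars F"

lemma lit_val_compl: "lit_val \<phi> (compl_lit x) = Some 1 \<longleftrightarrow> lit_val \<phi> x = Some 0"
proof (cases "\<phi> (var_lit x)")
  case None
  then show ?thesis by (cases x) auto
next
  case (Some b)
  then show ?thesis by (cases x; cases b) auto
qed

lemma lit_val_map_add:
  "lit_val (\<psi> ++ \<phi>) x = Some b \<longleftrightarrow> lit_val \<phi> x = Some b \<or> lit_val \<phi> x = None \<and> lit_val \<psi> x = Some b"
  by (cases x) (auto simp: map_add_def split: option.split)

lemma lit_val_map_le: "\<phi> \<subseteq>\<^sub>m \<psi> \<Longrightarrow> lit_val \<phi> x = Some b \<Longrightarrow> lit_val \<psi> x = Some b"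
  by (cases x) (auto simp: map_le_def dom_def)

lemma models_apply_pa: "models \<psi> (apply_pa \<phi> F) \<longleftrightarrow> models (\<psi> ++ \<phi>) F"
proof -
  have "(\<exists>x\<in>C. lit_val (\<psi> ++ \<phi>) x = Some 1) \<longleftrightarrow> (\<exists>x\<in>C. lit_val \<phi> x = Some 1) \<or>
      (\<exists>x\<in>C. lit_val \<phi> x \<noteq> Some 0 \<and> lit_val \<psi> x = Some 1)" for C
  proof -
    have "lit_val \<phi> x = None \<or> lit_val \<phi> x = Some 0 \<or> lit_val \<phi> x = Some 1" for x
      by (cases "lit_val \<phi> x"; cases "the (lit_val \<phi> x)") auto
    then show ?thesis unfolding lit_val_map_add by (metis option.distinct(1))
  qed
  then show ?thesis unfolding models_def apply_pa_def by auto
qed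

lemma satisfiable_iff_models: "satisfiable F \<longleftrightarrow> (\<exists>\<psi>. finite (dom \<psi>) \<and> models \<psi> F)"
  unfolding satisfiable_def is_passign_def apply_pa_def models_def by blast

lemma satisfiable_apply_pa_iff:
  assumes "finite (dom \<phi>)"
  shows "satisfiable (apply_pa \<phi> F) \<longleftrightarrow> (\<exists>\<psi>. finite (dom \<psi>) \<and> \<phi> \<subseteq>\<^sub>m \<psi> \<and> models \<psi> F)"
proof
  assume "satisfiable (apply_pa \<phi> F)"
  then obtain \<psi> where "finite (dom \<psi>)" "models (\<psi> ++ \<phi>) F"
    by (auto simp: satisfiable_iff_models models_apply_pa)
  then show "\<exists>\<psi>. finite (dom \<psi>) \<and> \<phi> \<subseteq>\<^sub>m \<psi> \<and> models \<psi> F"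
    using assms by (intro exI[of _ "\<psi> ++ \<phi>"]) auto
next
  assume "\<exists>\<psi>. finite (dom \<psi>) \<and> \<phi> \<subseteq>\<^sub>m \<psi> \<and> models \<psi> F"
  then obtain \<psi> where \<psi>: "finite (dom \<psi>)" "\<phi> \<subseteq>\<^sub>m \<psi>" "models \<psi> F" by blast
  have "\<psi> ++ \<phi> = \<psi>" using \<psi>(2) by (auto simp: map_add_def map_le_def dom_def split: option.split)
  with \<psi> show "satisfiable (apply_pa \<phi> F)" by (auto simp: satisfiable_iff_models models_apply_pa)
qed

lemma var_lit_compl [simp]: "var_lit (compl_lit x) = var_lit x"
  by (cases x) auto

lemma mem_lits_iff: "x \<in> lits F \<longleftrightarrow> var_lit x \<in> vars F"
  by (cases x) (auto simp: lits_def)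

lemma clause_mem_lits: "C \<in> F \<Longrightarrow> x \<in> C \<Longrightarrow> x \<in> lits F"
  by (auto simp: mem_lits_iff vars_def)

lemma compl_mem_lits: "x \<in> lits F \<Longrightarrow> compl_lit x \<in> lits F"
  by (simp add: mem_lits_iff)

lemma true_lits_subset_lits:
  assumes "dom \<phi> \<subseteq> vars F" shows "true_lits \<phi> \<subseteq> lits F"
proof
  fix x assume "x \<in> true_lits \<phi>"
  then have "var_lit x \<in> dom \<phi>" by (cases x) (auto simp: true_lits_def)
  then show "x \<in> lits F" using assms by (auto simp: mem_lits_iff)
qed

lemma finite_lits: "is_clause_set F \<Longrightarrow> finite (lits F)"
  by (simp add: lits_def finite_vars)

lemma card_lits_le:
  assumes "is_clause_set F" shows "card (lits F) \<le> 2 * lit_count F"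
proof -
  have "finite (\<Union>F)" using assms by (auto simp: is_clause_set_def is_clause_def)
  then have "card (vars F) \<le> card (\<Union>F)" unfolding vars_def by (rule card_image_le)
  also have "\<dots> \<le> lit_count F" unfolding lit_count_def by (rule card_Union_le_sum_card)
  finally have "card (vars F) \<le> lit_count F" .
  moreover have "card (lits F) \<le> card (Pos ` vars F) + card (Neg ` vars F)"
    unfolding lits_def by (rule card_Un_le)
  ultimately show ?thesis by (simp add: card_image inj_on_def)
qed

lemma card_clause_set_le:
  assumes "is_clause_set F" shows "card F \<le> lit_count F + 1"
proof -
  have fin: "finite F" "\<And>C. C \<in> F \<Longrightarrow> finite C" using assms by (auto simp: is_clause_set_def is_clause_def)
  have "card (F - {{}}) = (\<Sum>C\<in>F - {{}}. 1)" by simp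
  also have "\<dots> \<le> (\<Sum>C\<in>F - {{}}. card C)"
    using fin by (intro sum_mono) (auto simp: Suc_le_eq card_gt_0_iff)
  also have "\<dots> \<le> lit_count F" unfolding lit_count_def using fin by (intro sum_mono2) auto
  finally show ?thesis by (simp add: card_Diff_singleton_if split: if_splits)
qed

section \<open>Unit propagation in rounds\<close>

primrec derived :: "'v cls set \<Rightarrow> 'v lit set \<Rightarrow> nat \<Rightarrow> 'v lit set" where
  "derived F A 0 = A"
| "derived F A (Suc t) =
     derived F A t \<union> {y. \<exists>C\<in>F. y \<in> C \<and> (\<forall>z\<in>C - {y}. compl_lit z \<in> derived F A t)}"

definition refuted :: "'v cls set \<Rightarrow> 'v lit set \<Rightarrow> nat \<Rightarrow> bool" where
  "refuted F A t \<longleftrightarrow> (\<exists>C\<in>F. \<forall>z\<in>C. compl_lit z \<in> derived F A t)"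

lemma derived_subset_true_lits:
  assumes "models \<psi> F" "A \<subseteq> true_lits \<psi>"
  shows "derived F A t \<subseteq> true_lits \<psi>"
proof (induction t)
  case 0
  show ?case using assms(2) by simp
next
  case (Suc t)
  have "y \<in> true_lits \<psi>" if C: "C \<in> F" "\<forall>z\<in>C - {y}. compl_lit z \<in> derived F A t" for C y
  proof -
    obtain x where x: "x \<in> C" "lit_val \<psi> x = Some 1" using assms(1) C(1) by (auto simp: models_def)
    have "lit_val \<psi> z = Some 0" if "z \<in> C - {y}" for z
      using that C(2) Suc.IH lit_val_compl[of \<psi> z] by (auto simp: true_lits_def)
    then have "x = y" using x by force
    then show ?thesis using x(2) by (simp add: true_lits_def)
  qed
  then show ?case using Suc.IH by auto
qed

lemma models_not_refuted:
  assumes "models \<psi> F" "A \<subseteq> true_lits \<psi>"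
  shows "\<not> refuted F A t"
proof
  assume "refuted F A t"
  then obtain C where C: "C \<in> F" "\<And>z. z \<in> C \<Longrightarrow> compl_lit z \<in> derived F A t" by (auto simp: refuted_def)
  then obtain x where x: "x \<in> C" "lit_val \<psi> x = Some 1" using assms(1) by (auto simp: models_def)
  have "lit_val \<psi> (compl_lit x) = Some 1"
    using C(2)[OF x(1)] derived_subset_true_lits[OF assms] by (auto simp: true_lits_def)
  then show False using x(2) by (simp add: lit_val_compl)
qed

definition propagation_stable :: "'v lit set \<Rightarrow> 'v cls set \<Rightarrow> bool" where
  "propagation_stable P F \<longleftrightarrow> (\<forall>C\<in>F. (\<exists>z\<in>C. compl_lit z \<notin> P) \<and>
     (\<forall>y\<in>C. (\<forall>z\<in>C - {y}. compl_lit z \<in> P) \<longrightarrow> y \<in> P))"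

lemma propagation_stable_apply_pa:
  assumes "propagation_stable P F" "true_lits \<phi> \<subseteq> P"
  shows "propagation_stable P (apply_pa \<phi> F)"
  unfolding propagation_stable_def
proof
  fix C' assume "C' \<in> apply_pa \<phi> F"
  then obtain C where C: "C \<in> F" "C' = {x \<in> C. lit_val \<phi> x \<noteq> Some 0}" unfolding apply_pa_def by blast
  have deleted: "compl_lit x \<in> P" if "x \<in> C" "x \<notin> C'" for x
    using that C(2) assms(2) lit_val_compl[of \<phi> x] by (auto simp: true_lits_def)
  have "\<exists>z\<in>C. compl_lit z \<notin> P" using assms(1) C(1) by (auto simp: propagation_stable_def)
  then have "\<exists>z\<in>C'. compl_lit z \<notin> P" using deleted by blast
  moreover have "y \<in> P" if y: "y \<in> C'" "\<forall>z\<in>C' - {y}. compl_lit z \<in> P" for y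
  proof -
    have "\<forall>z\<in>C - {y}. compl_lit z \<in> P" using y(2) deleted by blast
    moreover have "y \<in> C" using y(1) C(2) by blast
    ultimately show ?thesis using assms(1) C(1) unfolding propagation_stable_def by blast
  qed
  ultimately show "(\<exists>z\<in>C'. compl_lit z \<notin> P) \<and>
      (\<forall>y\<in>C'. (\<forall>z\<in>C' - {y}. compl_lit z \<in> P) \<longrightarrow> y \<in> P)" by blast
qed

lemma propagation_stable_unit_prop:
  "unit_prop F G \<Longrightarrow> propagation_stable P F \<Longrightarrow> {} \<notin> G"
proof (induction rule: unit_prop.induct)
  case (conflict F)
  then show ?case unfolding propagation_stable_def by blast
next
  case (unit F x G)
  have "x \<in> P" using unit.prems unit.hyps(2) unfolding propagation_stable_def by blast
  then have "true_lits (set_true x) \<subseteq> P" by (auto simp: true_lits_def lit_val_set_true split: if_splits)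
  then show ?case using unit.prems by (intro unit.IH propagation_stable_apply_pa)
next
  case (stop F)
  then show ?case by blast
qed

lemma propagation_stable_r1:
  assumes "is_clause_set F" "propagation_stable P F" "true_lits \<phi> \<subseteq> P"
  shows "r1 (apply_pa \<phi> F) \<noteq> {{}}"
proof -
  have "vars (apply_pa \<phi> F) \<subseteq> vars F" unfolding vars_def apply_pa_def by blast
  then have "finite (vars (apply_pa \<phi> F))" using finite_vars[OF assms(1)] by (rule finite_subset)
  then obtain G where G: "unit_prop (apply_pa \<phi> F) G" using unit_prop_ex_finite by blast
  have "{} \<notin> G" using propagation_stable_unit_prop[OF G propagation_stable_apply_pa[OF assms(2,3)]] .
  then show ?thesis using r1_eq[OF G] by blast
qed

lemma derived_subset_lits: "A \<subseteq> lits F \<Longrightarrow> derived F A t \<subseteq> lits F"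
  by (induction t) (auto intro: clause_mem_lits)

lemma mono_derived: "mono (derived F A)"
  by (rule incseq_SucI) auto

lemma derived_subset_card_lits:
  assumes "is_clause_set F" "A \<subseteq> lits F"
  shows "derived F A t \<subseteq> derived F A (card (lits F))"
proof -
  have sub: "derived F A i \<subseteq> lits F" for i by (rule derived_subset_lits[OF assms(2)])
  have "finite (range (derived F A))"
    by (rule finite_subset[of _ "Pow (lits F)"]) (use sub finite_lits[OF assms(1)] in auto)
  then have "derived F A (card (lits F)) = (\<Union>i. derived F A i)"
    using sub finite_lits[OF assms(1)] mono_derived
    by (intro finite_mono_strict_prefix_implies_finite_fixpoint
        finite_mono_remains_stable_implies_strict_prefix) simp_all
  then show ?thesis by blast
qed

lemma propagation_stable_derived:
  assumes "is_clause_set F" "A \<subseteq> lits F" "\<not> refuted F A (card (lits F))"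
  shows "propagation_stable (derived F A (card (lits F))) F"
  unfolding propagation_stable_def
proof (intro ballI conjI impI)
  fix C assume C: "C \<in> F"
  then show "\<exists>z\<in>C. compl_lit z \<notin> derived F A (card (lits F))" using assms(3) by (auto simp: refuted_def)
  fix y assume "y \<in> C" "\<forall>z\<in>C - {y}. compl_lit z \<in> derived F A (card (lits F))"
  then have "y \<in> derived F A (Suc (card (lits F)))" using C by auto
  then show "y \<in> derived F A (card (lits F))" using derived_subset_card_lits[OF assms(1,2)] by blast
qed

lemma r1_conflict_imp_refuted:
  assumes "is_clause_set F" "dom \<phi> \<subseteq> vars F" "r1 (apply_pa \<phi> F) = {{}}"
  shows "refuted F (true_lits \<phi>) (card (lits F))"
proof (rule ccontr)
  assume "\<not> refuted F (true_lits \<phi>) (card (lits F))"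
  then have "propagation_stable (derived F (true_lits \<phi>) (card (lits F))) F"
    using assms(1) true_lits_subset_lits[OF assms(2)] by (intro propagation_stable_derived)
  moreover have "true_lits \<phi> \<subseteq> derived F (true_lits \<phi>) (card (lits F))"
    using monoD[OF mono_derived, of 0] by simp
  ultimately show False using propagation_stable_r1[OF assms(1)] assms(3) by blast
qed

lemma refuted_imp_unsatisfiable:
  assumes "finite (dom \<phi>)" "refuted F (true_lits \<phi>) t"
  shows "\<not> satisfiable (apply_pa \<phi> F)"
proof
  assume "satisfiable (apply_pa \<phi> F)"
  then obtain \<psi> where "\<phi> \<subseteq>\<^sub>m \<psi>" "models \<psi> F" using assms(1) by (auto simp: satisfiable_apply_pa_iff)
  moreover from this have "true_lits \<phi> \<subseteq> true_lits \<psi>" by (auto simp: true_lits_def lit_val_map_le)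
  ultimately show False using models_not_refuted assms(2) by blast
qed

lemma cnf_representation_satisfiable_iff:
  assumes "cnf_representation F' F" "finite (vars F)" "dom \<phi> \<subseteq> vars F"
  shows "satisfiable (apply_pa \<phi> F') \<longleftrightarrow> (\<exists>\<psi>. dom \<psi> = vars F \<and> \<phi> \<subseteq>\<^sub>m \<psi> \<and> xor_sat \<psi> F)"
proof -
  have fin: "finite (dom \<phi>)" using assms(3,2) by (rule finite_subset)
  have total: "satisfiable (apply_pa \<psi> F') \<longleftrightarrow> xor_sat \<psi> F" if "dom \<psi> = vars F" for \<psi>
    using assms(1) that by (simp add: cnf_representation_def)
  show ?thesis
  proof
    assume "satisfiable (apply_pa \<phi> F')"
    then obtain \<chi> where \<chi>: "finite (dom \<chi>)" "\<phi> \<subseteq>\<^sub>m \<chi>" "models \<chi> F'"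
      using fin by (auto simp: satisfiable_apply_pa_iff)
    define \<psi> where "\<psi> = (\<lambda>v. if v \<in> vars F then Some (case \<chi> v of None \<Rightarrow> 0 | Some b \<Rightarrow> b) else None)"
    have dom: "dom \<psi> = vars F" by (auto simp: \<psi>_def dom_def)
    have "\<chi> \<subseteq>\<^sub>m \<chi> ++ \<psi>" by (auto simp: \<psi>_def map_le_def map_add_def split: option.split)
    then have "models (\<chi> ++ \<psi>) F'" using \<chi>(3) lit_val_map_le unfolding models_def by blast
    then have "satisfiable (apply_pa \<psi> F')"
      using \<chi>(1) by (auto simp: satisfiable_iff_models models_apply_pa)
    moreover have "\<phi> \<subseteq>\<^sub>m \<psi>" using \<chi>(2) assms(3) by (force simp: \<psi>_def map_le_def split: option.split)
    ultimately show "\<exists>\<psi>. dom \<psi> = vars F \<and> \<phi> \<subseteq>\<^sub>m \<psi> \<and> xor_sat \<psi> F" using total dom by blast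
  next
    assume "\<exists>\<psi>. dom \<psi> = vars F \<and> \<phi> \<subseteq>\<^sub>m \<psi> \<and> xor_sat \<psi> F"
    then obtain \<psi> where \<psi>: "dom \<psi> = vars F" "\<phi> \<subseteq>\<^sub>m \<psi>" "xor_sat \<psi> F" by blast
    then have "satisfiable (apply_pa \<psi> F')" using total by blast
    then show "satisfiable (apply_pa \<phi> F')"
      using \<psi>(1,2) fin assms(2) by (auto simp: satisfiable_apply_pa_iff intro: map_le_trans)
  qed
qed

lemma ur_representation_refuted_iff:
  assumes "ur_representation F' F" "finite (vars F)" "dom \<phi> \<subseteq> vars F"
  shows "refuted F' (true_lits \<phi>) (card (lits F')) \<longleftrightarrow>
    \<not> (\<exists>\<psi>. dom \<psi> = vars F \<and> \<phi> \<subseteq>\<^sub>m \<psi> \<and> xor_sat \<psi> F)"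
proof -
  have cnf: "cnf_representation F' F" "is_clause_set F'" "vars F \<subseteq> vars F'"
    using assms(1) by (simp_all add: ur_representation_def cnf_representation_def)
  have fin: "finite (dom \<phi>)" using assms(3,2) by (rule finite_subset)
  have "refuted F' (true_lits \<phi>) (card (lits F'))" if "\<not> satisfiable (apply_pa \<phi> F')"
  proof (rule r1_conflict_imp_refuted[OF cnf(2)])
    show "dom \<phi> \<subseteq> vars F'" using assms(3) cnf(3) by blast
    show "r1 (apply_pa \<phi> F') = {{}}"
      using assms(1,3) fin that by (simp add: ur_representation_def is_passign_def)
  qed
  then show ?thesis
    using refuted_imp_unsatisfiable[OF fin] cnf_representation_satisfiable_iff[OF cnf(1) assms(2,3)]
    by blast
qed

section \<open>Unit propagation as a monotone circuit\<close>

lemma monotone_circuit_not_derived: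
  assumes F: "is_clause_set F" and inputs: "\<And>y. y \<in> lits F \<Longrightarrow> (\<lambda>S. y \<notin> A S) \<in> input_gates"
  shows "\<exists>G. monotone_circuit (t * (card (lits F) * card F)) G \<and>
    (\<forall>y\<in>lits F. (\<lambda>S. y \<notin> derived F (A S) t) \<in> G)"
proof (induction t)
  case 0
  show ?case using inputs monotone_circuit.inputs by auto
next
  case (Suc t)
  then obtain G where G: "monotone_circuit (t * (card (lits F) * card F)) G"
    "\<And>y. y \<in> lits F \<Longrightarrow> (\<lambda>S. y \<notin> derived F (A S) t) \<in> G" by blast
  let ?clauses = "\<lambda>y. {C \<in> F. y \<in> C}"
  let ?blocked = "\<lambda>y C S. \<exists>z\<in>C - {y}. compl_lit z \<notin> derived F (A S) t"
  have fin: "finite F" using F by (simp add: is_clause_set_def)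
  have "\<exists>G'. monotone_circuit (t * (card (lits F) * card F) + card (lits F) * card F) G' \<and>
      disjunctions G \<subseteq> G' \<and>
      (\<forall>y\<in>lits F. (\<lambda>S. y \<notin> derived F (A S) t \<and> (\<forall>C\<in>?clauses y. ?blocked y C S)) \<in> G')"
  proof (rule monotone_circuit_family_Ball[OF finite_lits[OF F] monotone_circuit.disj[OF G(1)]])
    fix y assume y: "y \<in> lits F"
    show "finite (?clauses y) \<and> card (?clauses y) \<le> card F" using fin by (auto intro: card_mono)
    show "(\<lambda>S. y \<notin> derived F (A S) t) \<in> disjunctions G" using G(2)[OF y] subset_disjunctions by blast
    show "?blocked y C \<in> disjunctions G" if "C \<in> ?clauses y" for C
      using that by (intro disjunctionsI G(2) compl_mem_lits clause_mem_lits[of C]) auto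
  qed
  moreover have "(\<lambda>S. y \<notin> derived F (A S) t \<and> (\<forall>C\<in>?clauses y. ?blocked y C S)) =
      (\<lambda>S. y \<notin> derived F (A S) (Suc t))" for y by auto
  ultimately show ?case by (auto simp: add.commute)
qed

lemma monotone_circuit_not_refuted:
  assumes F: "is_clause_set F" and inputs: "\<And>y. y \<in> lits F \<Longrightarrow> (\<lambda>S. y \<notin> A S) \<in> input_gates"
  shows "\<exists>G. monotone_circuit (t * (card (lits F) * card F) + card F) G \<and> (\<lambda>S. \<not> refuted F (A S) t) \<in> G"
proof -
  obtain G where G: "monotone_circuit (t * (card (lits F) * card F)) G"
    "\<And>y. y \<in> lits F \<Longrightarrow> (\<lambda>S. y \<notin> derived F (A S) t) \<in> G"
    using monotone_circuit_not_derived[OF assms] by blast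
  let ?open = "\<lambda>C S. \<exists>z\<in>C. compl_lit z \<notin> derived F (A S) t"
  have "(\<lambda>S. True) \<in> disjunctions G"
    using input_gates_subset[OF G(1)] subset_disjunctions by (auto simp: input_gates_def)
  moreover have "?open C \<in> disjunctions G" if "C \<in> F" for C
    using that by (intro disjunctionsI G(2) compl_mem_lits clause_mem_lits[of C])
  moreover have "finite F" using F by (simp add: is_clause_set_def)
  ultimately obtain G' where "monotone_circuit (t * (card (lits F) * card F) + card F) G'"
    "(\<lambda>S. True \<and> (\<forall>C\<in>F. ?open C S)) \<in> G'"
    using monotone_circuit_Ball[OF _ monotone_circuit.disj[OF G(1)], of F "\<lambda>S. True" ?open] by blast
  moreover have "(\<lambda>S. True \<and> (\<forall>C\<in>F. ?open C S)) = (\<lambda>S. \<not> refuted F (A S) t)"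
    by (auto simp: refuted_def)
  ultimately show ?thesis by auto
qed

lemma propagation_circuit_size_le:
  assumes "is_clause_set F"
  shows "card (lits F) * (card (lits F) * card F) + card F \<le> 4 * (lit_count F + 2) ^ 3"
proof -
  let ?l = "lit_count F"
  have "card (lits F) * (card (lits F) * card F) + card F \<le> (2 * ?l) * ((2 * ?l) * (?l + 1)) + (?l + 1)"
    using card_lits_le[OF assms] card_clause_set_le[OF assms] by (intro add_mono mult_le_mono)
  also have "\<dots> \<le> 4 * (?l + 2) ^ 3" by (simp add: power3_eq_cube algebra_simps)
  finally show ?thesis .
qed

section \<open>The odd factor constraints\<close>

text \<open>An XOR-clause requires an even sum; negating the literal with index 0 makes it odd.\<close>

definition odd_lit :: "(nat \<Rightarrow> 'v) \<Rightarrow> nat \<Rightarrow> 'v lit" where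
  "odd_lit v m = (if m = 0 then Neg (v m) else Pos (v m))"

definition odd_clause :: "nat \<Rightarrow> (nat \<Rightarrow> 'v) \<Rightarrow> 'v cls" where
  "odd_clause n v = odd_lit v ` {..<n}"

definition odd_factor_xor :: "nat \<Rightarrow> nat cls set" where
  "odd_factor_xor n = (\<lambda>i. odd_clause n (\<lambda>j. prod_encode (i, j))) ` {..<n}
     \<union> (\<lambda>j. odd_clause n (\<lambda>i. prod_encode (i, j))) ` {..<n}"

definition true_edges :: "nat \<Rightarrow> nat passign \<Rightarrow> (nat \<times> nat) set" where
  "true_edges n \<psi> = {(i, j) \<in> {..<n} \<times> {..<n}. \<psi> (prod_encode (i, j)) = Some 1}"

definition exclude_edges :: "nat \<Rightarrow> (nat \<times> nat) set \<Rightarrow> nat passign" where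
  "exclude_edges n S v = (if prod_decode v \<in> {..<n} \<times> {..<n} - S then Some 0 else None)"

lemma var_lit_odd_lit [simp]: "var_lit (odd_lit v m) = v m"
  by (simp add: odd_lit_def)

lemma var_lit_odd_clause: "var_lit ` odd_clause n v = v ` {..<n}"
  by (simp add: odd_clause_def image_image)

lemma is_clause_odd_clause:
  assumes "inj_on v {..<n}" shows "is_clause (odd_clause n v)"
  unfolding is_clause_def
proof (intro conjI ballI notI)
  show "finite (odd_clause n v)" by (simp add: odd_clause_def)
  have inj: "inj_on var_lit (odd_clause n v)"
    unfolding odd_clause_def using assms by (intro inj_on_imageI) (simp add: comp_def)
  fix x assume "x \<in> odd_clause n v" "compl_lit x \<in> odd_clause n v"
  then have "compl_lit x = x" by (intro inj_onD[OF inj]) simp_all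
  then show False by simp
qed

lemma card_odd_clause_le: "card (odd_clause n v) \<le> n"
  unfolding odd_clause_def by (rule order_trans[OF card_image_le]) simp_all

lemma of_nat_bit_eq_1_iff: "(of_nat m :: bit) = 1 \<longleftrightarrow> odd m"
  by (induction m) (auto simp: bit_not_one_iff)

lemma sum_odd_clause_eq_0_iff:
  assumes "0 < n" "inj_on v {..<n}" "v ` {..<n} \<subseteq> dom \<psi>"
  shows "(\<Sum>x\<in>odd_clause n v. the (lit_val \<psi> x)) = 0 \<longleftrightarrow> odd (card {m. m < n \<and> \<psi> (v m) = Some 1})"
proof -
  have lit_val_odd_lit: "the (lit_val \<psi> (odd_lit v m))
      = (if m = 0 then 1 else 0) + (if \<psi> (v m) = Some 1 then 1 else 0)"
    if "m < n" for m
  proof -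
    have "v m \<in> dom \<psi>" using that assms(3) by auto
    then obtain b where "\<psi> (v m) = Some b" by blast
    then show ?thesis by (cases b) (auto simp: odd_lit_def)
  qed
  have "inj_on (odd_lit v) {..<n}" using assms(2) by (auto simp: inj_on_def odd_lit_def split: if_splits)
  then have "(\<Sum>x\<in>odd_clause n v. the (lit_val \<psi> x)) = (\<Sum>m<n. the (lit_val \<psi> (odd_lit v m)))"
    unfolding odd_clause_def by (rule sum.reindex_cong) simp_all
  also have "\<dots> = (\<Sum>m<n. (if m = 0 then 1 else 0) + (if \<psi> (v m) = Some 1 then 1 else 0))"
    using lit_val_odd_lit by (intro sum.cong) auto
  also have "\<dots> = (\<Sum>m<n. if m = 0 then 1 else 0) + (\<Sum>m<n. if \<psi> (v m) = Some 1 then 1 else 0)"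
    by (rule sum.distrib)
  also have "(\<Sum>m<n. if m = 0 then 1 else 0 :: bit) = 1" using assms(1) by (subst sum.delta) auto
  also have "(\<Sum>m<n. if \<psi> (v m) = Some 1 then 1 else 0)
      = (of_nat (card {m. m < n \<and> \<psi> (v m) = Some 1}) :: bit)"
  proof -
    have "{..<n} \<inter> {m. \<psi> (v m) = Some 1} = {m. m < n \<and> \<psi> (v m) = Some 1}" by auto
    then show ?thesis by (simp add: sum.If_cases)
  qed
  finally have sum: "(\<Sum>x\<in>odd_clause n v. the (lit_val \<psi> x))
      = 1 + of_nat (card {m. m < n \<and> \<psi> (v m) = Some 1})" .
  have "1 + b = 0 \<longleftrightarrow> b = 1" for b :: bit by (cases b) auto
  then show ?thesis by (simp only: sum of_nat_bit_eq_1_iff)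
qed

lemma is_clause_set_odd_factor_xor: "is_clause_set (odd_factor_xor n)"
  by (auto simp: is_clause_set_def odd_factor_xor_def inj_on_def intro!: is_clause_odd_clause)

lemma vars_odd_factor_xor: "vars (odd_factor_xor n) = prod_encode ` ({..<n} \<times> {..<n})"
proof -
  have "vars (odd_factor_xor n) = (\<Union>C\<in>odd_factor_xor n. var_lit ` C)" by (auto simp: vars_def)
  also have "\<dots> = prod_encode ` ({..<n} \<times> {..<n})"
    by (auto simp: odd_factor_xor_def var_lit_odd_clause)
  finally show ?thesis .
qed

lemma lit_count_odd_factor_xor_le: "lit_count (odd_factor_xor n) \<le> 2 * n\<^sup>2"
proof -
  have "card C \<le> n" if "C \<in> odd_factor_xor n" for C
    using that card_odd_clause_le by (auto simp: odd_factor_xor_def)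
  then have "lit_count (odd_factor_xor n) \<le> card (odd_factor_xor n) * n"
    unfolding lit_count_def using sum_bounded_above[of "odd_factor_xor n" card n] by simp
  also have "card (odd_factor_xor n) \<le> n + n"
    unfolding odd_factor_xor_def
    by (intro order_trans[OF card_Un_le] add_mono; rule order_trans[OF card_image_le]) simp_all
  finally show ?thesis by (simp add: power2_eq_square algebra_simps)
qed

lemma xor_sat_odd_factor_xor_iff:
  assumes "dom \<psi> = vars (odd_factor_xor n)"
  shows "xor_sat \<psi> (odd_factor_xor n) \<longleftrightarrow> odd_factor {..<n} (true_edges n \<psi>)"
proof -
  have "(\<Sum>x\<in>odd_clause n (\<lambda>j. prod_encode (i, j)). the (lit_val \<psi> x)) = 0
      \<longleftrightarrow> odd (card {j. (i, j) \<in> true_edges n \<psi>})" if "i < n" for i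
    using that assms by (subst sum_odd_clause_eq_0_iff)
      (auto simp: inj_on_def vars_odd_factor_xor true_edges_def)
  moreover have "(\<Sum>x\<in>odd_clause n (\<lambda>i. prod_encode (i, j)). the (lit_val \<psi> x)) = 0
      \<longleftrightarrow> odd (card {i. (i, j) \<in> true_edges n \<psi>})" if "j < n" for j
    using that assms by (subst sum_odd_clause_eq_0_iff)
      (auto simp: inj_on_def vars_odd_factor_xor true_edges_def)
  moreover have "true_edges n \<psi> \<subseteq> {..<n} \<times> {..<n}" by (auto simp: true_edges_def)
  ultimately show ?thesis by (simp add: xor_sat_def odd_factor_xor_def odd_factor_def ball_Un)
qed

lemma dom_exclude_edges: "dom (exclude_edges n S) \<subseteq> vars (odd_factor_xor n)"
proof
  fix v assume "v \<in> dom (exclude_edges n S)"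
  then have "prod_decode v \<in> {..<n} \<times> {..<n}" by (auto simp: exclude_edges_def split: if_splits)
  then show "v \<in> vars (odd_factor_xor n)"
    unfolding vars_odd_factor_xor by (metis imageI prod_decode_inverse)
qed

lemma true_edges_subset:
  assumes "exclude_edges n S \<subseteq>\<^sub>m \<psi>" shows "true_edges n \<psi> \<subseteq> S"
proof (rule ccontr)
  assume "\<not> true_edges n \<psi> \<subseteq> S"
  then obtain e where e: "e \<in> {..<n} \<times> {..<n} - S" "\<psi> (prod_encode e) = Some 1"
    by (auto simp: true_edges_def)
  then have "exclude_edges n S (prod_encode e) = Some 0" by (simp add: exclude_edges_def)
  then have "\<psi> (prod_encode e) = Some 0" using assms by (metis domI map_le_def)
  then show False using e(2) by simp
qed

lemma has_odd_factor_iff_xor_sat: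
  "has_odd_factor {..<n} S \<longleftrightarrow>
    (\<exists>\<psi>. dom \<psi> = vars (odd_factor_xor n) \<and> exclude_edges n S \<subseteq>\<^sub>m \<psi> \<and>
      xor_sat \<psi> (odd_factor_xor n))" (is "_ \<longleftrightarrow> ?rhs")
proof
  assume "has_odd_factor {..<n} S"
  then obtain R where R: "R \<subseteq> S" "odd_factor {..<n} R" by (auto simp: has_odd_factor_def)
  define \<psi> :: "nat passign" where "\<psi> v =
    (if v \<in> vars (odd_factor_xor n) then Some (if prod_decode v \<in> R then 1 else 0) else None)" for v
  have dom: "dom \<psi> = vars (odd_factor_xor n)" by (auto simp: \<psi>_def dom_def)
  have "true_edges n \<psi> = R"
    using R(2) by (auto simp: true_edges_def \<psi>_def vars_odd_factor_xor odd_factor_def)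
  then have "xor_sat \<psi> (odd_factor_xor n)" using R(2) dom by (simp add: xor_sat_odd_factor_xor_iff)
  moreover have "exclude_edges n S \<subseteq>\<^sub>m \<psi>"
    unfolding map_le_def
  proof
    fix v assume "v \<in> dom (exclude_edges n S)"
    then show "exclude_edges n S v = \<psi> v"
      using dom_exclude_edges R(1) by (auto simp: exclude_edges_def \<psi>_def split: if_splits)
  qed
  ultimately show ?rhs using dom by blast
next
  assume ?rhs
  then obtain \<psi> where "dom \<psi> = vars (odd_factor_xor n)" "exclude_edges n S \<subseteq>\<^sub>m \<psi>"
    "xor_sat \<psi> (odd_factor_xor n)" by blast
  then show "has_odd_factor {..<n} S"
    unfolding has_odd_factor_def
    by (intro exI[of _ "true_edges n \<psi>"]) (simp add: true_edges_subset xor_sat_odd_factor_xor_iff)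
qed

lemma not_mem_true_lits_exclude_edges: "(\<lambda>S. x \<notin> true_lits (exclude_edges n S)) \<in> input_gates"
proof (cases "\<exists>v. x = Neg v \<and> prod_decode v \<in> {..<n} \<times> {..<n}")
  case True
  then obtain v where "x = Neg v" "prod_decode v \<in> {..<n} \<times> {..<n}" by (elim exE conjE)
  then have "(\<lambda>S. x \<notin> true_lits (exclude_edges n S)) = (\<lambda>S. prod_decode v \<in> S)"
    by (simp add: true_lits_def exclude_edges_def)
  then show ?thesis by (simp add: input_gates_def)
next
  case False
  then have "(\<lambda>S. x \<notin> true_lits (exclude_edges n S)) = (\<lambda>S. True)"
    by (cases x) (auto simp: true_lits_def exclude_edges_def)
  then show ?thesis by (simp add: input_gates_def)
qed

theorem ur_representation_odd_factor_circuit: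
  assumes "ur_representation F (odd_factor_xor n)"
  obtains G where "monotone_circuit (4 * (lit_count F + 2) ^ 3) G" "has_odd_factor {..<n} \<in> G"
proof -
  have F: "is_clause_set F" using assms by (simp add: ur_representation_def cnf_representation_def)
  obtain G where G: "monotone_circuit (card (lits F) * (card (lits F) * card F) + card F) G"
    "(\<lambda>S. \<not> refuted F (true_lits (exclude_edges n S)) (card (lits F))) \<in> G"
    using monotone_circuit_not_refuted[OF F not_mem_true_lits_exclude_edges] by blast
  have "finite (vars (odd_factor_xor n))" by (simp add: vars_odd_factor_xor)
  then have "refuted F (true_lits (exclude_edges n S)) (card (lits F)) \<longleftrightarrow> \<not> has_odd_factor {..<n} S" for S
    unfolding has_odd_factor_iff_xor_sat
    by (rule ur_representation_refuted_iff[OF assms _ dom_exclude_edges])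
  then have "(\<lambda>S. \<not> refuted F (true_lits (exclude_edges n S)) (card (lits F))) = has_odd_factor {..<n}"
    by simp
  then show ?thesis using that G monotone_circuit_mono propagation_circuit_size_le[OF F] by auto
qed

section \<open>Superpolynomial size\<close>

lemma poly_le_power:
  fixes p :: "real poly"
  shows "\<exists>c. \<forall>m :: nat. poly p (real m) \<le> real ((m + 2) ^ c)"
proof (induction p)
  case 0
  show ?case by simp
next
  case (pCons a p)
  then obtain c where c: "\<And>m :: nat. poly p (real m) \<le> real ((m + 2) ^ c)" by blast
  obtain A :: nat where A: "a \<le> real A" using real_arch_simple by blast
  have "poly (pCons a p) (real m) \<le> real ((m + 2) ^ (A + c + 2))" for m
  proof -
    have "A \<le> (m + 2) ^ A" using less_exp[of A] power_mono[of 2 "m + 2" A] by simp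
    also have "\<dots> \<le> (m + 2) ^ (A + c + 1)" by (intro power_increasing) auto
    finally have A_le: "A \<le> (m + 2) ^ (A + c + 1)" .
    have "m * (m + 2) ^ c \<le> (m + 2) ^ (c + 1)" by simp
    also have "\<dots> \<le> (m + 2) ^ (A + c + 1)" by (intro power_increasing) auto
    finally have "A + m * (m + 2) ^ c \<le> 2 * (m + 2) ^ (A + c + 1)" using A_le by simp
    also have "\<dots> \<le> (m + 2) ^ (A + c + 2)" by simp
    finally have "real (A + m * (m + 2) ^ c) \<le> real ((m + 2) ^ (A + c + 2))" by (rule of_nat_mono)
    moreover have "poly (pCons a p) (real m) \<le> real A + real m * real ((m + 2) ^ c)"
      using A c[of m] by (simp add: add_mono mult_left_mono)
    ultimately show ?thesis by simp
  qed
  then show ?case by blast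
qed

lemma polynomial_size_less_two_power_square:
  assumes "l \<le> (2 * (2 ^ (20 * k))\<^sup>2 + 2) ^ c" "126 * c + 9 \<le> k"
  shows "4 * (l + 2) ^ 3 < (2::nat) ^ (k * k)"
proof -
  have "2 * (2 ^ (20 * k))\<^sup>2 + 2 \<le> (2::nat) ^ (40 * k + 2)" by (simp flip: power_mult)
  also have "\<dots> \<le> 2 ^ (42 * k)" using assms(2) by (intro power_increasing) auto
  finally have "(2 * (2 ^ (20 * k))\<^sup>2 + 2) ^ c \<le> ((2::nat) ^ (42 * k)) ^ c" by (rule power_mono) simp
  also have "\<dots> = 2 ^ (42 * c * k)" by (simp add: mult_ac flip: power_mult)
  finally have "l \<le> 2 ^ (42 * c * k)" using assms(1) by simp
  moreover have "1 \<le> (2::nat) ^ (42 * c * k)" by simp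
  moreover have "(2::nat) ^ (42 * c * k + 2) = 4 * 2 ^ (42 * c * k)" by simp
  ultimately have "l + 2 \<le> 2 ^ (42 * c * k + 2)" by linarith
  then have "4 * (l + 2) ^ 3 \<le> 2 ^ 2 * (2 ^ (42 * c * k + 2)) ^ 3"
    by (intro mult_le_mono power_mono) auto
  also have "\<dots> = 2 ^ (2 + (42 * c * k + 2) * 3)" by (simp only: power_add power_mult)
  also have "\<dots> < 2 ^ (k * k)"
  proof (rule power_strict_increasing)
    have "(126 * c + 9) * k \<le> k * k" using assms(2) by (rule mult_le_mono1)
    then show "2 + (42 * c * k + 2) * 3 < k * k" using assms(2) by (simp add: algebra_simps)
  qed simp
  finally show ?thesis .
qed

theorem theorem11p2:
  shows "\<not> (\<exists>p :: real poly. \<forall>F :: nat cls set. is_clause_set F \<longrightarrow>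
           (\<exists>F' :: nat cls set. ur_representation F' F \<and>
              real (lit_count F') \<le> poly p (real (lit_count F))))"
proof (rule notI, elim exE)
  fix p :: "real poly"
  assume p: "\<forall>F :: nat cls set. is_clause_set F \<longrightarrow>
    (\<exists>F' :: nat cls set. ur_representation F' F \<and> real (lit_count F') \<le> poly p (real (lit_count F)))"
  obtain c where c: "\<And>m :: nat. poly p (real m) \<le> real ((m + 2) ^ c)" using poly_le_power by blast
  define k where "k = 126 * c + 20"
  let ?F = "odd_factor_xor (2 ^ (20 * k))"
  obtain F' where F': "ur_representation F' ?F" "real (lit_count F') \<le> poly p (real (lit_count ?F))"
    using p is_clause_set_odd_factor_xor by blast
  obtain G where "monotone_circuit (4 * (lit_count F' + 2) ^ 3) G"
    "has_odd_factor {..<2 ^ (20 * k) :: nat} \<in> G"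
    using ur_representation_odd_factor_circuit[OF F'(1)] .
  then have lower: "2 ^ (k * k) \<le> 4 * (lit_count F' + 2) ^ 3"
    by (intro odd_factor_circuit_lower_bound) (simp_all add: k_def)
  have "lit_count F' \<le> (lit_count ?F + 2) ^ c" using F'(2) c[of "lit_count ?F"] by linarith
  also have "\<dots> \<le> (2 * (2 ^ (20 * k))\<^sup>2 + 2) ^ c" by (simp add: lit_count_odd_factor_xor_le power_mono)
  finally have "4 * (lit_count F' + 2) ^ 3 < 2 ^ (k * k)"
    by (rule polynomial_size_less_two_power_square) (simp add: k_def)
  with lower show False by simp
qed

end
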